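(* Let $\mathcal{G}$ be a $\sigma$-compact, locally compact, Hausdorff, étale groupoid with compact unit space $\mathcal{G}^{(0)}$, and suppose that its dynamic asymptotic dimension growth $f$ satisfies $f\preceq x^{\alpha}$ for some $0<\alpha<1$ (that is, $\mathrm{dad}_{\mathcal{G}}\preceq x^{\alpha}$, where $\mathrm{dad}_{\mathcal{G}}$ is the dynamic asymptotic dimension function of $\mathcal{G}$ with respect to a coarse continuous length function $\ell$ on $\mathcal{G}$). Then $\mathcal{G}$ is amenable.
   Context: Precompact means having compact closure. A length function on a groupoid $\mathcal{G}$ (source $s$, range $r$) is $\ell:\mathcal{G}\to[0,\infty)$ with $\ell(x)=0$ iff $x\in\mathcal{G}^{(0)}$; $\ell(x)=\ell(x^{-1})$; $\ell(xy)\le\ell(x)+\ell(y)$ for composable $x,y$. When $\mathcal{G}^{(0)}$ is compact, $\ell$ is coarse if for every $K\subseteq\mathcal{G}$: $\sup_{K}\ell<\infty$ if and only if $K$ is precompact. It is continuous if it is continuous on $\mathcal{G}$. (Every $\sigma$-compact locally compact Hausdorff étale groupoid has a coarse continuous length function.) Dynamic asymptotic dimension function: for an étale groupoid $\mathcal{G}$ with compact unit space and coarse continuous length function $\ell$, and $R>0$, $\mathrm{dad}_{\mathcal{G}}(R)$ is the smallest $m\in\mathbb{N}$ such that, with $K=\{z\in\mathcal{G}\mid\ell(z)<R\}$, there is an open cover $\{U_0,\dots,U_m\}$ of $\mathcal{G}^{(0)}$ such that for each $i$ the set $\{g\in K\mid s(g),r(g)\in U_i\}$ is contained in a precompact subgroupoid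 of $\mathcal{G}$. The dynamic asymptotic dimension growth is the growth type of $\mathrm{dad}_{\mathcal{G}}$. Growth: for $f,g:\mathbb{R}^{+}\to\mathbb{R}^{+}$ write $f\preceq g$ if there is $k\in\mathbb{N}$ with $f(x)\le k\,g(kx+k)+k$ for all $x>k$; the growth type of $f$ is its class under $f\approx g\Leftrightarrow(f\preceq g$ and $g\preceq f)$. Amenability: with $\mathcal{G}_x=s^{-1}(x)$, a locally compact Hausdorff étale groupoid $\mathcal{G}$ is amenable if for all compact $K\subseteq\mathcal{G}$ and all $\varepsilon>0$ there is a continuous, compactly supported $\mu:\mathcal{G}\to[0,1]$ such that (1) $\sum_{g\in\mathcal{G}_x}\mu(g)\le1$ for all $x\in\mathcal{G}^{(0)}$; (2) $|1-\sum_{g\in\mathcal{G}_{r(k)}}\mu(g)|<\varepsilon$ for all $k\in K$; (3) $\sum_{g\in\mathcal{G}_{r(k)}}|\mu(g)-\mu(gk)|<\varepsilon$ for all $k\in K$. *)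

theory Defs
  imports "HOL-Analysis.Analysis"
begin

text \<open>
  The arrows are the points of \<^term>\<open>topspace (gtop G)\<close>, and units are identified with identity
  arrows. The product \<open>x \<cdot> y\<close> is meaningful only if \<open>src x = rng y\<close>; it is a total
  function whose values on non-composable pairs are irrelevant.
\<close>

record 'a top_groupoid =
  gtop :: "'a topology"
  src :: "'a \<Rightarrow> 'a"
  rng :: "'a \<Rightarrow> 'a"
  gmult :: "'a \<Rightarrow> 'a \<Rightarrow> 'a" (infixl "\<cdot>\<index>" 70)
  ginv :: "'a \<Rightarrow> 'a"

definition arrows :: "('a, 'b) top_groupoid_scheme \<Rightarrow> 'a set" where
  "arrows G = topspace (gtop G)"

definition units :: "('a, 'b) top_groupoid_scheme \<Rightarrow> 'a set" where
  "units G = {u \<in> arrows G. src G u = u \<and> rng G u = u}"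

definition unit_space :: "('a, 'b) top_groupoid_scheme \<Rightarrow> 'a topology" where
  "unit_space G = subtopology (gtop G) (units G)"

definition composable :: "('a, 'b) top_groupoid_scheme \<Rightarrow> ('a \<times> 'a) set" where
  "composable G = {(x, y). x \<in> arrows G \<and> y \<in> arrows G \<and> src G x = rng G y}"

locale groupoid =
  fixes G :: "('a, 'b) top_groupoid_scheme" (structure)
  assumes src_unit: "x \<in> arrows G \<Longrightarrow> src G x \<in> units G"
    and rng_unit: "x \<in> arrows G \<Longrightarrow> rng G x \<in> units G"
    and mult_arrow: "(x, y) \<in> composable G \<Longrightarrow> x \<cdot> y \<in> arrows G"
    and src_mult: "(x, y) \<in> composable G \<Longrightarrow> src G (x \<cdot> y) = src G y"
    and rng_mult: "(x, y) \<in> composable G \<Longrightarrow> rng G (x \<cdot> y) = rng G x"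
    and mult_assoc:
      "(x, y) \<in> composable G \<Longrightarrow> (y, z) \<in> composable G \<Longrightarrow> (x \<cdot> y) \<cdot> z = x \<cdot> (y \<cdot> z)"
    and rng_mult_left: "x \<in> arrows G \<Longrightarrow> rng G x \<cdot> x = x"
    and mult_src_right: "x \<in> arrows G \<Longrightarrow> x \<cdot> src G x = x"
    and inv_arrow: "x \<in> arrows G \<Longrightarrow> ginv G x \<in> arrows G"
    and src_inv: "x \<in> arrows G \<Longrightarrow> src G (ginv G x) = rng G x"
    and rng_inv: "x \<in> arrows G \<Longrightarrow> rng G (ginv G x) = src G x"
    and mult_inv: "x \<in> arrows G \<Longrightarrow> x \<cdot> ginv G x = rng G x"
    and inv_mult: "x \<in> arrows G \<Longrightarrow> ginv G x \<cdot> x = src G x"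

text \<open>Continuity of \<open>src\<close> and \<open>rng\<close> follows from the two axioms below.\<close>

locale topological_groupoid = groupoid +
  assumes continuous_mult:
      "continuous_map (subtopology (prod_topology (gtop G) (gtop G)) (composable G)) (gtop G)
        (\<lambda>(x, y). x \<cdot> y)"
    and continuous_inv: "continuous_map (gtop G) (gtop G) (ginv G)"

definition local_homeomorphism :: "'a topology \<Rightarrow> 'b topology \<Rightarrow> ('a \<Rightarrow> 'b) \<Rightarrow> bool" where
  "local_homeomorphism X Y f \<longleftrightarrow>
    (\<forall>x \<in> topspace X. \<exists>U. openin X U \<and> x \<in> U \<and> openin Y (f ` U) \<and>
      homeomorphic_map (subtopology X U) (subtopology Y (f ` U)) f)"

locale etale_groupoid = topological_groupoid +
  assumes local_homeomorphism_src: "local_homeomorphism (gtop G) (unit_space G) (src G)"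
    and local_homeomorphism_rng: "local_homeomorphism (gtop G) (unit_space G) (rng G)"

definition sigma_compact_space :: "'a topology \<Rightarrow> bool" where
  "sigma_compact_space X \<longleftrightarrow>
    (\<exists>C :: nat \<Rightarrow> 'a set. (\<forall>n. compactin X (C n)) \<and> (\<Union>n. C n) = topspace X)"

definition precompactin :: "'a topology \<Rightarrow> 'a set \<Rightarrow> bool" where
  "precompactin X K \<longleftrightarrow> K \<subseteq> topspace X \<and> compactin X (X closure_of K)"

definition subgroupoid :: "('a, 'b) top_groupoid_scheme \<Rightarrow> 'a set \<Rightarrow> bool" where
  "subgroupoid G H \<longleftrightarrow>
    H \<subseteq> arrows G \<and>
    (\<forall>x \<in> H. src G x \<in> H \<and> rng G x \<in> H \<and> ginv G x \<in> H) \<and>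
    (\<forall>x \<in> H. \<forall>y \<in> H. src G x = rng G y \<longrightarrow> x \<cdot>\<^bsub>G\<^esub> y \<in> H)"

definition length_function :: "('a, 'b) top_groupoid_scheme \<Rightarrow> ('a \<Rightarrow> real) \<Rightarrow> bool" where
  "length_function G l \<longleftrightarrow>
    (\<forall>x \<in> arrows G. 0 \<le> l x) \<and>
    (\<forall>x \<in> arrows G. l x = 0 \<longleftrightarrow> x \<in> units G) \<and>
    (\<forall>x \<in> arrows G. l x = l (ginv G x)) \<and>
    (\<forall>(x, y) \<in> composable G. l (x \<cdot>\<^bsub>G\<^esub> y) \<le> l x + l y)"

definition coarse_length :: "('a, 'b) top_groupoid_scheme \<Rightarrow> ('a \<Rightarrow> real) \<Rightarrow> bool" where
  "coarse_length G l \<longleftrightarrow>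
    (\<forall>K. K \<subseteq> arrows G \<longrightarrow> (bdd_above (l ` K) \<longleftrightarrow> precompactin (gtop G) K))"

text \<open>
  The infimum is \<open>\<infinity>\<close> if no admissible \<open>m\<close> exists, as happens for instance if an isotropy group
  meets \<open>{z. l z < R}\<close> in an element of infinite order.
\<close>

definition dad :: "('a, 'b) top_groupoid_scheme \<Rightarrow> ('a \<Rightarrow> real) \<Rightarrow> real \<Rightarrow> enat" where
  "dad G l R = (INF m \<in> {m :: nat. \<exists>U :: nat \<Rightarrow> 'a set.
      (\<forall>i \<le> m. openin (unit_space G) (U i)) \<and>
      (\<Union>i \<le> m. U i) = units G \<and>
      (\<forall>i \<le> m. \<exists>H. subgroupoid G H \<and> precompactin (gtop G) H \<and>
        {g \<in> arrows G. l g < R \<and> src G g \<in> U i \<and> rng G g \<in> U i} \<subseteq> H)}. enat m)"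

text \<open>Values in \<^typ>\<open>ereal\<close> because \<^const>\<open>dad\<close> may be infinite.\<close>

definition growth_le :: "(real \<Rightarrow> ereal) \<Rightarrow> (real \<Rightarrow> ereal) \<Rightarrow> bool" where
  "growth_le f g \<longleftrightarrow>
    (\<exists>k :: nat. \<forall>x > real k.
      f x \<le> ereal (real k) * g (real k * x + real k) + ereal (real k))"

text \<open>
  The infinite sums below have only finitely many nonzero terms when \<open>G\<close> is etale and Hausdorff,
  since the fibres of \<open>src\<close> are then closed and discrete and \<open>\<mu>\<close> has compact support.
\<close>

definition amenable :: "('a, 'b) top_groupoid_scheme \<Rightarrow> bool" where
  "amenable G \<longleftrightarrow>
    (\<forall>K (\<epsilon> :: real). compactin (gtop G) K \<and> 0 < \<epsilon> \<longrightarrow>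
      (\<exists>\<mu> :: 'a \<Rightarrow> real.
        continuous_map (gtop G) (top_of_set {0..1}) \<mu> \<and>
        compactin (gtop G) (gtop G closure_of {g \<in> arrows G. \<mu> g \<noteq> 0}) \<and>
        (\<forall>x \<in> units G. (\<Sum>\<^sub>\<infinity>g \<in> {g \<in> arrows G. src G g = x}. \<mu> g) \<le> 1) \<and>
        (\<forall>k \<in> K. \<bar>1 - (\<Sum>\<^sub>\<infinity>g \<in> {g \<in> arrows G. src G g = rng G k}. \<mu> g)\<bar> < \<epsilon>) \<and>
        (\<forall>k \<in> K. (\<Sum>\<^sub>\<infinity>g \<in> {g \<in> arrows G. src G g = rng G k}. \<bar>\<mu> g - \<mu> (g \<cdot>\<^bsub>G\<^esub> k)\<bar>) < \<epsilon>)))"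

end

theory Submission
  imports Defs
begin

text \<open>
  Given a compact set on which the length is at most \<open>L\<close>, take \<open>r\<close> large and an open cover
  \<open>U\<^sub>0, \<dots>, U\<^sub>m\<close> of the unit space realising \<open>m = dad (4 r)\<close>. Spreading bump functions supported
  in the sets \<open>U\<^sub>i\<close> at scale \<open>r\<close> gives functions \<open>\<phi>\<^sub>i\<close> on the units which are
  \<open>1/r\<close>-Lipschitz along arrows and one of which is \<open>1\<close> at each unit. Arrows of length less than
  \<open>2 L\<close> between points of the support of \<open>\<phi>\<^sub>i\<close> can be moved by arrows of length less than \<open>r\<close>
  into the precompact subgroupoid attached to \<open>U\<^sub>i\<close>, so all their products have bounded length. Hence
  the largest kernel \<open>w\<^sub>i\<close> on arrows obtained by chaining such arrows is continuous with compact
  support (the chaining stabilises after finitely many steps because the fibres of the source map have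
  boundedly many points in a compact set), and it is exactly invariant under right multiplication by
  arrows of length at most \<open>L\<close> near which \<open>\<phi>\<^sub>i\<close> is not small. Averaging the normalised \<open>w\<^sub>i\<close> with
  weights built from the \<open>\<phi>\<^sub>i\<close> yields a mean whose defect of invariance is at most \<open>4 (m + 1) L / r\<close>,
  which tends to \<open>0\<close> since \<open>m\<close> grows like \<open>r\<^sup>\<alpha>\<close> with \<open>\<alpha> < 1\<close>.
\<close>

subsection \<open>Suprema and bump functions on topological spaces\<close>

text \<open>The inserted \<open>0\<close> is the value over an empty fibre; for functions bounded
  above it makes the supremum total and nonnegative.\<close>

definition fibre_sup :: "'x topology \<Rightarrow> ('x \<Rightarrow> 'y) \<Rightarrow> ('x \<Rightarrow> real) \<Rightarrow> 'y \<Rightarrow> real" where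
  "fibre_sup X p F y = Sup (insert 0 (F ` {x \<in> topspace X. p x = y}))"

lemma less_fibre_sup_iff:
  assumes "\<And>x. x \<in> topspace X \<Longrightarrow> F x \<le> 1" and "0 \<le> t"
  shows "t < fibre_sup X p F y \<longleftrightarrow> (\<exists>x \<in> topspace X. p x = y \<and> t < F x)"
proof -
  have "bdd_above (insert 0 (F ` {x \<in> topspace X. p x = y}))"
    unfolding bdd_above_insert using assms(1) by (auto intro!: bdd_aboveI)
  then show ?thesis
    unfolding fibre_sup_def by (subst less_cSup_iff) (use assms(2) in auto)
qed

lemma fibre_sup_bounds:
  assumes "\<And>x. x \<in> topspace X \<Longrightarrow> F x \<le> 1"
  shows "0 \<le> fibre_sup X p F y" "fibre_sup X p F y \<le> 1"
proof -
  have "bdd_above (insert 0 (F ` {x \<in> topspace X. p x = y}))"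
    unfolding bdd_above_insert using assms by (auto intro!: bdd_aboveI)
  then show "0 \<le> fibre_sup X p F y"
    unfolding fibre_sup_def by (rule cSup_upper[rotated]) simp
  show "fibre_sup X p F y \<le> 1"
    unfolding fibre_sup_def by (rule cSup_least) (use assms in auto)
qed

lemma fibre_sup_ge:
  assumes "\<And>x. x \<in> topspace X \<Longrightarrow> F x \<le> 1" and "x \<in> topspace X"
  shows "F x \<le> fibre_sup X p F (p x)"
  using less_fibre_sup_iff[of X F, OF assms(1), of "fibre_sup X p F (p x)" p "p x"]
    fibre_sup_bounds(1)[of X F p "p x", OF assms(1)] assms(2) by force

text \<open>Openness of \<open>p\<close> gives lower semicontinuity: a strict superlevel set is the
  image of an open set. Upper semicontinuity holds because the superlevel sets of \<open>F\<close>
  at positive levels are compact, so their images are closed in the Hausdorff space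
  \<open>Y\<close>.\<close>

lemma continuous_map_fibre_sup:
  assumes p: "open_map X Y p" "continuous_map X Y p" and "Hausdorff_space Y"
    and F: "continuous_map X euclideanreal F" and F1: "\<And>x. x \<in> topspace X \<Longrightarrow> F x \<le> 1"
    and cpt: "\<And>t. 0 < t \<Longrightarrow> compactin X {x \<in> topspace X. t \<le> F x}"
  shows "continuous_map Y euclideanreal (fibre_sup X p F)"
  unfolding continuous_map_upper_lower_semicontinuous_lt
proof (intro conjI allI)
  fix a :: real
  have op: "openin X {x \<in> topspace X. a < F x}"
    using F by (simp add: continuous_map_upper_lower_semicontinuous_lt)
  show "openin Y {y \<in> topspace Y. a < fibre_sup X p F y}"
  proof (cases "a < 0")
    case True
    then have "{y \<in> topspace Y. a < fibre_sup X p F y} = topspace Y"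
      using fibre_sup_bounds(1)[of X F p, OF F1] by (auto intro: less_le_trans)
    then show ?thesis by simp
  next
    case False
    then have "{y \<in> topspace Y. a < fibre_sup X p F y} = p ` {x \<in> topspace X. a < F x}"
      using continuous_map_image_subset_topspace[OF p(2)]
      by (auto simp: less_fibre_sup_iff[of X F, OF F1])
    then show ?thesis using p(1) op by (simp add: open_map_def)
  qed
  have "\<exists>V. openin Y V \<and> y \<in> V \<and> V \<subseteq> {y \<in> topspace Y. fibre_sup X p F y < a}"
    if y: "y \<in> topspace Y" "fibre_sup X p F y < a" for y
  proof -
    \<comment> \<open>A supremum of values below \<open>a\<close> could equal \<open>a\<close>;
      excluding the values at least \<open>s\<close> for an intermediate \<open>s\<close> keeps it
      at most \<open>s\<close>, hence strictly below \<open>a\<close>.\<close>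
    obtain s where s: "fibre_sup X p F y < s" "s < a" using dense[OF y(2)] by blast
    have s0: "0 < s" using fibre_sup_bounds(1)[of X F p y, OF F1] s by linarith
    define V where "V = topspace Y - p ` {x \<in> topspace X. s \<le> F x}"
    have "closedin Y (p ` {x \<in> topspace X. s \<le> F x})"
      using assms(3) cpt[OF s0] p(2) by (blast intro: compactin_imp_closedin image_compactin)
    then have "openin Y V" unfolding V_def by blast
    moreover have "y \<in> V"
      unfolding V_def using y s fibre_sup_ge[of X F _ p, OF F1] by fastforce
    moreover have "fibre_sup X p F z < a" if "z \<in> V" for z
    proof -
      have "\<not> s < fibre_sup X p F z"
        using that s0 by (auto simp: V_def less_fibre_sup_iff[of X F, OF F1])
      then show ?thesis using s by linarith
    qed
    ultimately show ?thesis unfolding V_def by blast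
  qed
  then show "openin Y {y \<in> topspace Y. fibre_sup X p F y < a}"
    by (subst openin_subopen) blast
qed

lemma closedin_superlevel:
  assumes "continuous_map X euclideanreal f"
  shows "closedin X {x \<in> topspace X. t \<le> f x}"
  using assms by (simp add: continuous_map_upper_lower_semicontinuous_le)

lemma exists_bump:
  assumes "completely_regular_space X" "openin X V" "x \<in> V"
  obtains f :: "'a \<Rightarrow> real" where "continuous_map X euclideanreal f" "f x = 1"
    "\<And>y. y \<in> topspace X \<Longrightarrow> f y \<in> {0..1}" "\<And>y. y \<in> topspace X - V \<Longrightarrow> f y = 0"
proof -
  have "closedin X (topspace X - V)" "x \<in> topspace X - (topspace X - V)"
    using assms openin_subset by blast+
  then obtain f :: "'a \<Rightarrow> real" where f: "continuous_map X (top_of_set {0..1}) f" "f x = 0"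
    "f ` (topspace X - V) \<subseteq> {1}"
    using assms(1) unfolding completely_regular_space_def by blast
  show thesis
  proof
    show "continuous_map X euclideanreal (\<lambda>x. 1 - f x)"
      by (intro continuous_map_diff continuous_map_canonical_const
          continuous_map_into_fulltopology[OF f(1)])
    show "1 - f y \<in> {0..1}" if "y \<in> topspace X" for y
    proof -
      have "f y \<in> {0..1}" using continuous_map_image_subset_topspace[OF f(1)] that by auto
      then show ?thesis by auto
    qed
    show "1 - f y = 0" if "y \<in> topspace X - V" for y
      using f(3) that by auto
  qed (simp add: f(2))
qed

text \<open>Each point of \<open>C\<close> gets a bump function equal to \<open>1\<close> there, and
  the open sets where the bumps exceed \<open>1/2\<close> have a finite subcover. The uniform bound
  \<open>1/2\<close> permits dividing by the sum of the bumps, or doubling it and truncating at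
  \<open>1\<close>.\<close>

lemma compactin_bump_cover:
  assumes X: "completely_regular_space X" and C: "compactin X C"
    and V: "\<forall>x \<in> C. openin X (V x) \<and> x \<in> V x"
  shows "\<exists>D (f :: 'a \<Rightarrow> 'a \<Rightarrow> real). finite D \<and> D \<subseteq> C \<and>
    (\<forall>x \<in> D. continuous_map X euclideanreal (f x)) \<and>
    (\<forall>x \<in> D. \<forall>y \<in> topspace X. f x y \<in> {0..1}) \<and>
    (\<forall>x \<in> D. \<forall>y \<in> topspace X - V x. f x y = 0) \<and>
    (\<forall>y \<in> C. \<exists>x \<in> D. 1/2 < f x y)"
proof -
  have "\<exists>f :: 'a \<Rightarrow> real. continuous_map X euclideanreal f \<and> f x = 1 \<and>
      (\<forall>y \<in> topspace X. f y \<in> {0..1}) \<and> (\<forall>y \<in> topspace X - V x. f y = 0)" if "x \<in> C" for x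
    using exists_bump[OF X, of "V x" x] V that by metis
  then obtain f :: "'a \<Rightarrow> 'a \<Rightarrow> real" where f: "\<And>x. x \<in> C \<Longrightarrow> continuous_map X euclideanreal (f x)"
    "\<And>x. x \<in> C \<Longrightarrow> f x x = 1" "\<And>x y. x \<in> C \<Longrightarrow> y \<in> topspace X \<Longrightarrow> f x y \<in> {0..1}"
    "\<And>x y. x \<in> C \<Longrightarrow> y \<in> topspace X - V x \<Longrightarrow> f x y = 0"
    by metis
  define Op where "Op x = {y \<in> topspace X. 1/2 < f x y}" for x
  have "openin X (Op x)" if "x \<in> C" for x
    using f(1)[OF that] unfolding Op_def continuous_map_upper_lower_semicontinuous_lt by blast
  then have "\<forall>S \<in> Op ` C. openin X S" by blast
  moreover have "C \<subseteq> \<Union> (Op ` C)"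
  proof
    fix x assume "x \<in> C"
    then have "x \<in> Op x" using f(2) compactin_subset_topspace[OF C] by (auto simp: Op_def)
    then show "x \<in> \<Union> (Op ` C)" using \<open>x \<in> C\<close> by blast
  qed
  ultimately obtain F where "finite F" "F \<subseteq> Op ` C" "C \<subseteq> \<Union> F"
    using C unfolding compactin_def by meson
  then obtain D where "D \<subseteq> C" "finite D" "F = Op ` D"
    using finite_subset_image[of F Op C] by blast
  show ?thesis
  proof (intro exI conjI ballI)
    show "\<exists>x \<in> D. 1/2 < f x y" if "y \<in> C" for y
      using that \<open>C \<subseteq> \<Union> F\<close> \<open>F = Op ` D\<close> unfolding Op_def by blast
  qed (use f(1,3,4) \<open>D \<subseteq> C\<close> \<open>finite D\<close> in blast)+
qed

text \<open>\<open>N + 1\<close> successive strict inclusions would put more than \<open>N\<close>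
  points into \<open>B\<close>, so two neighbours coincide early on, and the recursion
  \<open>\<Gamma>\<close> then keeps the chain constant. The index \<open>N\<close> depends only on
  the bound for \<open>card B\<close>.\<close>

lemma stable_chain:
  fixes A :: "nat \<Rightarrow> 'a set"
  assumes mono: "\<And>n. A n \<subseteq> A (Suc n)" and step: "\<And>n. A (Suc n) = \<Gamma> (A n)"
    and B: "finite B" "card B \<le> N" "\<And>n. A n \<subseteq> B"
  shows "A (Suc N) = A N"
proof -
  have "\<exists>n \<le> N. A (Suc n) = A n"
  proof (rule ccontr)
    assume "\<not> ?thesis"
    then have str: "A n \<subset> A (Suc n)" if "n \<le> N" for n using mono[of n] that by blast
    have "n \<le> card (A n)" if "n \<le> Suc N" for n
      using that
    proof (induction n)
      case (Suc n)
      then have "card (A n) < card (A (Suc n))"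
        using str[of n] by (intro psubset_card_mono finite_subset[OF B(3) B(1)]) auto
      then show ?case using Suc by simp
    qed simp
    then have "Suc N \<le> card (A (Suc N))" by blast
    also have "\<dots> \<le> card B" by (intro card_mono B)
    finally show False using B by simp
  qed
  then obtain n where n: "n \<le> N" "A (Suc n) = A n" by blast
  have "A (Suc m) = A m" if "n \<le> m" for m
    using that
  proof (induction m rule: dec_induct)
    case (step m)
    then show ?case using assms(2)[of "Suc m"] assms(2)[of m] by simp
  qed (rule n)
  then show ?thesis using n by blast
qed

subsection \<open>Groupoids with a coarse continuous length function\<close>

context groupoid
begin

lemma units_subset: "units G \<subseteq> arrows G"
  by (auto simp: units_def)

lemma rng_in_arrows: "x \<in> arrows G \<Longrightarrow> rng G x \<in> arrows G"
  using rng_unit units_subset by auto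

lemma mult_closed:
  assumes "x \<in> arrows G" "y \<in> arrows G" "src G x = rng G y"
  shows "x \<cdot> y \<in> arrows G" "src G (x \<cdot> y) = src G y" "rng G (x \<cdot> y) = rng G x"
  using assms mult_arrow[of x y] src_mult[of x y] rng_mult[of x y] by (auto simp: composable_def)

lemma assoc:
  assumes "x \<in> arrows G" "y \<in> arrows G" "z \<in> arrows G" "src G x = rng G y" "src G y = rng G z"
  shows "(x \<cdot> y) \<cdot> z = x \<cdot> (y \<cdot> z)"
  using mult_assoc[of x y z] assms by (auto simp: composable_def)

lemma mult_inv_cancel_right:
  assumes "x \<in> arrows G" "y \<in> arrows G" "src G x = rng G y"
  shows "(x \<cdot> y) \<cdot> ginv G y = x"
proof -
  have "(x \<cdot> y) \<cdot> ginv G y = x \<cdot> (y \<cdot> ginv G y)"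
    using assms by (intro assoc inv_arrow) (simp_all add: rng_inv)
  then show ?thesis using assms mult_src_right[of x] by (simp add: mult_inv)
qed

lemma mult_inv_cancel_right':
  assumes "x \<in> arrows G" "y \<in> arrows G" "src G x = src G y"
  shows "(x \<cdot> ginv G y) \<cdot> y = x"
proof -
  have "(x \<cdot> ginv G y) \<cdot> y = x \<cdot> (ginv G y \<cdot> y)"
    using assms by (intro assoc inv_arrow) (simp_all add: rng_inv src_inv)
  then show ?thesis using assms mult_src_right[of x] by (simp add: inv_mult)
qed

lemma mult_inv_cancel_left:
  assumes "x \<in> arrows G" "y \<in> arrows G" "src G x = rng G y"
  shows "ginv G x \<cdot> (x \<cdot> y) = y"
proof -
  have "(ginv G x \<cdot> x) \<cdot> y = ginv G x \<cdot> (x \<cdot> y)"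
    using assms by (intro assoc inv_arrow) (simp_all add: src_inv)
  then show ?thesis using assms rng_mult_left[of y] by (simp add: inv_mult)
qed

end

context etale_groupoid
begin

lemma topspace_unit_space: "topspace (unit_space G) = units G"
  using units_subset by (auto simp: unit_space_def arrows_def)

end

section \<open>Local homeomorphisms are open, continuous and locally injective\<close>

lemma local_homeomorphism_imp_open_map:
  assumes "local_homeomorphism X Y f"
  shows "open_map X Y f"
  unfolding open_map_def
proof (intro allI impI)
  fix W assume W: "openin X W"
  have "\<exists>T. openin Y T \<and> f x \<in> T \<and> T \<subseteq> f ` W" if "x \<in> W" for x
  proof -
    obtain U where U: "openin X U" "x \<in> U" "openin Y (f ` U)"
      "homeomorphic_map (subtopology X U) (subtopology Y (f ` U)) f"
      using assms \<open>x \<in> W\<close> openin_subset[OF W] unfolding local_homeomorphism_def by blast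
    have "openin (subtopology X U) (U \<inter> W)" using W U by (simp add: openin_subtopology_Int2)
    then have "openin (subtopology Y (f ` U)) (f ` (U \<inter> W))"
      using U(4) homeomorphic_imp_open_map open_map_def by blast
    then have "openin Y (f ` (U \<inter> W))" using U(3) openin_trans_full by blast
    then show ?thesis using U \<open>x \<in> W\<close> by (intro exI[of _ "f ` (U \<inter> W)"]) auto
  qed
  then show "openin Y (f ` W)" by (subst openin_subopen) blast
qed

lemma local_homeomorphism_imp_continuous_map:
  assumes "local_homeomorphism X Y f"
  shows "continuous_map X Y f"
  unfolding continuous_map_def
proof (intro conjI allI impI)
  have loc: "\<exists>U. openin X U \<and> x \<in> U \<and> continuous_map (subtopology X U) Y f"
    if "x \<in> topspace X" for x
    using assms that unfolding local_homeomorphism_def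
    by (meson continuous_map_into_fulltopology homeomorphic_imp_continuous_map)
  show "f \<in> topspace X \<rightarrow> topspace Y"
  proof
    fix x assume "x \<in> topspace X"
    then show "f x \<in> topspace Y"
      using loc[of x] by (auto simp: continuous_map_def Pi_iff)
  qed
  fix V assume V: "openin Y V"
  have "\<exists>T. openin X T \<and> x \<in> T \<and> T \<subseteq> {x \<in> topspace X. f x \<in> V}"
    if x: "x \<in> topspace X" "f x \<in> V" for x
  proof -
    obtain U where U: "openin X U" "x \<in> U" "continuous_map (subtopology X U) Y f"
      using loc[OF x(1)] by blast
    have "openin (subtopology X U) {z \<in> topspace (subtopology X U). f z \<in> V}"
      using U(3) V openin_continuous_map_preimage by blast
    then have "openin X {z \<in> topspace (subtopology X U). f z \<in> V}"
      using U(1) openin_trans_full by blast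
    then show ?thesis using U x by (intro exI[of _ "{z \<in> topspace (subtopology X U). f z \<in> V}"]) auto
  qed
  then show "openin X {x \<in> topspace X. f x \<in> V}" by (subst openin_subopen) blast
qed

lemma local_homeomorphism_locally_injective:
  assumes "local_homeomorphism X Y f" "x \<in> topspace X"
  obtains V where "openin X V" "x \<in> V" "inj_on f V"
proof -
  obtain U where U: "openin X U" "x \<in> U"
    "homeomorphic_map (subtopology X U) (subtopology Y (f ` U)) f"
    using assms unfolding local_homeomorphism_def by blast
  then have "inj_on f (topspace (subtopology X U))" using homeomorphic_imp_injective_map by blast
  moreover have "topspace (subtopology X U) = U" using openin_subset[OF U(1)] by auto
  ultimately show thesis using that U by simp
qed

section \<open>Compact balls and uniformly finite source fibres\<close>

locale coarse_groupoid = etale_groupoid +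
  fixes l :: "'a \<Rightarrow> real"
  assumes Hausdorff: "Hausdorff_space (gtop G)"
    and locally_compact: "locally_compact_space (gtop G)"
    and compact_units: "compact_space (unit_space G)"
    and length: "length_function G l"
    and coarse: "coarse_length G l"
    and continuous_length: "continuous_map (gtop G) euclideanreal l"
begin

lemma length_nonneg: "x \<in> arrows G \<Longrightarrow> 0 \<le> l x"
  and length_unit: "x \<in> units G \<Longrightarrow> l x = 0"
  and length_inv: "x \<in> arrows G \<Longrightarrow> l (ginv G x) = l x"
  using length units_subset by (auto simp: length_function_def)

lemma length_mult:
  "x \<in> arrows G \<Longrightarrow> y \<in> arrows G \<Longrightarrow> src G x = rng G y \<Longrightarrow> l (x \<cdot> y) \<le> l x + l y"
  using length by (auto simp: length_function_def composable_def)

text \<open>Coarseness gives compact closure, and continuity of \<open>l\<close> makes the ball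
  closed, so the ball is its own closure.\<close>

lemma compactin_ball: "compactin (gtop G) {g \<in> arrows G. l g \<le> T}"
proof -
  let ?B = "{g \<in> arrows G. l g \<le> T}"
  have "bdd_above (l ` ?B)" by (auto intro: bdd_aboveI)
  then have "precompactin (gtop G) ?B" using coarse by (simp add: coarse_length_def)
  moreover have "closedin (gtop G) ?B"
    using continuous_length by (simp add: continuous_map_upper_lower_semicontinuous_le arrows_def)
  ultimately show ?thesis by (simp add: precompactin_def closure_of_closedin)
qed

lemma compactin_superlevel:
  assumes "continuous_map (gtop G) euclideanreal F" and "\<And>g. g \<in> arrows G \<Longrightarrow> T < l g \<Longrightarrow> F g = 0"
    and "0 < t"
  shows "compactin (gtop G) {g \<in> topspace (gtop G). t \<le> F g}"
  using assms(2,3)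
  by (intro closed_compactin[OF compactin_ball[of T] _ closedin_superlevel[OF assms(1)]])
    (force simp: arrows_def)

lemma bounded_on_compact: "compactin (gtop G) K \<Longrightarrow> bdd_above (l ` K)"
  using image_compactin[OF _ continuous_length, of K]
  by (simp add: compactin_euclidean_iff compact_imp_bounded bounded_imp_bdd_above)

lemma bounded_on_precompact: "precompactin (gtop G) K \<Longrightarrow> bdd_above (l ` K)"
  using coarse by (auto simp: coarse_length_def precompactin_def arrows_def)

lemma continuous_src: "continuous_map (gtop G) (unit_space G) (src G)"
  and continuous_rng: "continuous_map (gtop G) (unit_space G) (rng G)"
  using local_homeomorphism_src local_homeomorphism_rng local_homeomorphism_imp_continuous_map by blast+

lemma open_src: "open_map (gtop G) (unit_space G) (src G)"
  using local_homeomorphism_src local_homeomorphism_imp_open_map by blast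

lemma continuous_comp_src:
    "continuous_map (unit_space G) X f \<Longrightarrow> continuous_map (gtop G) X (\<lambda>g. f (src G g))"
  and continuous_comp_rng:
    "continuous_map (unit_space G) X f \<Longrightarrow> continuous_map (gtop G) X (\<lambda>g. f (rng G g))"
  using continuous_map_compose[OF continuous_src, of X f] continuous_map_compose[OF continuous_rng, of X f]
  by (simp_all add: o_def)

lemma Hausdorff_units: "Hausdorff_space (unit_space G)"
  by (simp add: Hausdorff Hausdorff_space_subtopology unit_space_def)

lemma completely_regular: "completely_regular_space (gtop G)"
  using Hausdorff locally_compact locally_compact_Hausdorff_or_regular
    locally_compact_regular_imp_completely_regular_space by blast

lemma completely_regular_units: "completely_regular_space (unit_space G)"
  by (simp add: completely_regular completely_regular_space_subtopology unit_space_def)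

definition fibre :: "real \<Rightarrow> 'a \<Rightarrow> 'a set" where
  "fibre T x = {g \<in> arrows G. src G g = x \<and> l g \<le> T}"

text \<open>The source map is locally injective, so compactness of the ball yields finitely many
  charts \<open>V v\<close>, each meeting a source fibre at most once, with bumps subordinate to
  them.\<close>

lemma ball_bump_cover:
  "\<exists>D V (f :: 'a \<Rightarrow> 'a \<Rightarrow> real). finite D \<and> (\<forall>v \<in> D. inj_on (src G) (V v)) \<and>
    (\<forall>v \<in> D. continuous_map (gtop G) euclideanreal (f v)) \<and>
    (\<forall>v \<in> D. \<forall>g \<in> arrows G. f v g \<in> {0..1}) \<and>
    (\<forall>v \<in> D. \<forall>g \<in> arrows G - V v. f v g = 0) \<and>
    (\<forall>g \<in> {g \<in> arrows G. l g \<le> T}. \<exists>v \<in> D. 1/2 < f v g)"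
proof -
  have "\<exists>V. openin (gtop G) V \<and> g \<in> V \<and> inj_on (src G) V" if "g \<in> {g \<in> arrows G. l g \<le> T}" for g
    using that local_homeomorphism_locally_injective[OF local_homeomorphism_src, of g]
    by (auto simp: arrows_def)
  then obtain V where V: "\<And>g. g \<in> {g \<in> arrows G. l g \<le> T} \<Longrightarrow>
      openin (gtop G) (V g) \<and> g \<in> V g \<and> inj_on (src G) (V g)"
    by metis
  then have "\<forall>g \<in> {g \<in> arrows G. l g \<le> T}. openin (gtop G) (V g) \<and> g \<in> V g"
    by blast
  from compactin_bump_cover[OF completely_regular compactin_ball[of T] this]
  obtain D and f :: "'a \<Rightarrow> 'a \<Rightarrow> real" where
    D: "finite D" "D \<subseteq> {g \<in> arrows G. l g \<le> T}"
    and f: "\<forall>v \<in> D. continuous_map (gtop G) euclideanreal (f v)"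
    "\<forall>v \<in> D. \<forall>g \<in> topspace (gtop G). f v g \<in> {0..1}"
    "\<forall>v \<in> D. \<forall>g \<in> topspace (gtop G) - V v. f v g = 0"
    "\<forall>g \<in> {g \<in> arrows G. l g \<le> T}. \<exists>v \<in> D. 1/2 < f v g"
    by (elim exE conjE)
  moreover have "\<forall>v \<in> D. inj_on (src G) (V v)" using V D(2) by blast
  ultimately show ?thesis
    by (intro exI[of _ D] exI[of _ V] exI[of _ f] conjI) (simp_all only: arrows_def)
qed

text \<open>Every arrow of the ball lies in one of finitely many charts, and a chart holds at most
  one arrow of a given source, so the number of charts bounds every fibre uniformly.\<close>

lemma fibre_bound:
  obtains N where "\<And>x. finite (fibre T x) \<and> card (fibre T x) \<le> N"
proof -
  from ball_bump_cover[of T]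
  obtain D V and f :: "'a \<Rightarrow> 'a \<Rightarrow> real" where D: "finite D"
    and inj: "\<forall>v \<in> D. inj_on (src G) (V v)"
    and f: "\<forall>v \<in> D. \<forall>g \<in> arrows G - V v. f v g = 0"
    "\<forall>g \<in> {g \<in> arrows G. l g \<le> T}. \<exists>v \<in> D. 1/2 < f v g"
    by (elim exE conjE)
  have "finite (fibre T x) \<and> card (fibre T x) \<le> card D" for x
  proof -
    have "\<exists>v \<in> D. g \<in> V v" if "g \<in> fibre T x" for g
    proof -
      have "g \<in> arrows G" "l g \<le> T" using that by (auto simp: fibre_def)
      then obtain v where "v \<in> D" "1/2 < f v g" using f(2) by blast
      moreover have "g \<in> V v" proof (rule ccontr)
        assume "g \<notin> V v"
        then have "f v g = 0" using f(1) \<open>v \<in> D\<close> \<open>g \<in> arrows G\<close> by blast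
        then show False using \<open>1/2 < f v g\<close> by simp
      qed
      ultimately show ?thesis by blast
    qed
    then obtain w where w: "\<And>g. g \<in> fibre T x \<Longrightarrow> w g \<in> D \<and> g \<in> V (w g)" by metis
    have "inj_on w (fibre T x)"
    proof (rule inj_onI)
      fix g h assume "g \<in> fibre T x" "h \<in> fibre T x" "w g = w h"
      then have "inj_on (src G) (V (w g))" "g \<in> V (w g)" "h \<in> V (w g)" "src G g = src G h"
        using w[of g] w[of h] inj by (auto simp: fibre_def)
      then show "g = h" by (meson inj_onD)
    qed
    moreover have "w ` fibre T x \<subseteq> D" using w by blast
    ultimately show ?thesis using D inj_on_finite card_inj_on_le by blast
  qed
  then show thesis using that by blast
qed

section \<open>Sums over source fibres and their continuity\<close>

definition fsum :: "('a \<Rightarrow> real) \<Rightarrow> 'a \<Rightarrow> real" where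
  "fsum F x = (\<Sum>\<^sub>\<infinity>g \<in> {g \<in> arrows G. src G g = x}. F g)"

lemma finite_fibre: "finite (fibre T x)"
  using fibre_bound[of T] by metis

lemma fsum_eq:
  assumes "\<And>g. g \<in> arrows G \<Longrightarrow> T < l g \<Longrightarrow> F g = 0"
  shows "fsum F x = sum F (fibre T x)"
proof -
  have "fsum F x = infsum F (fibre T x)"
    unfolding fsum_def by (rule infsum_cong_neutral) (use assms in \<open>auto simp: fibre_def not_le\<close>)
  then show ?thesis by (simp add: finite_fibre)
qed

text \<open>At most one arrow of a fibre lies in \<open>V\<close>, so the sum has at most one
  nonzero term and agrees with the supremum. Continuity of suprema thus passes to sums.\<close>

lemma sum_fibre_eq_fibre_sup:
  assumes inj: "inj_on (src G) V" and h1: "\<And>g. g \<in> arrows G \<Longrightarrow> h g \<in> {0..1}"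
    and h0: "\<And>g. g \<in> arrows G \<Longrightarrow> g \<notin> V \<or> T < l g \<Longrightarrow> h g = 0"
  shows "sum h (fibre T x) = fibre_sup (gtop G) (src G) h x"
proof (cases "\<exists>g \<in> fibre T x. 0 < h g")
  case True
  then obtain g where g: "g \<in> fibre T x" "0 < h g" by blast
  then have gx: "g \<in> arrows G" "src G g = x" by (auto simp: fibre_def)
  have uniq: "g' = g" if "g' \<in> arrows G" "src G g' = x" "0 < h g'" for g'
  proof -
    have "g' \<in> V" "g \<in> V" using h0[of g'] h0[of g] that g gx by auto
    then show ?thesis using inj that gx by (auto dest: inj_onD)
  qed
  have "sum h (fibre T x) = sum h {g}"
  proof (rule sum.mono_neutral_right)
    show "\<forall>g' \<in> fibre T x - {g}. h g' = 0"
    proof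
      fix g' assume g': "g' \<in> fibre T x - {g}"
      then have "g' \<in> arrows G" "src G g' = x" by (auto simp: fibre_def)
      then show "h g' = 0" using uniq[of g'] h1[of g'] g' by fastforce
    qed
  qed (use g finite_fibre in auto)
  moreover have "h g \<le> fibre_sup (gtop G) (src G) h x"
    using fibre_sup_ge[of "gtop G" h g "src G"] gx h1 by (simp add: arrows_def)
  moreover have "\<not> h g < fibre_sup (gtop G) (src G) h x"
  proof
    assume "h g < fibre_sup (gtop G) (src G) h x"
    then obtain g' where "g' \<in> arrows G" "src G g' = x" "h g < h g'"
      using less_fibre_sup_iff[of "gtop G" h "h g" "src G" x] g h1 by (auto simp: arrows_def)
    then show False using uniq[of g'] g by fastforce
  qed
  ultimately show ?thesis by simp
next
  case False
  have "h g = 0" if "g \<in> fibre T x" for g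
    using False that h1[of g] by (fastforce simp: fibre_def)
  then have "sum h (fibre T x) = 0" by simp
  moreover have "\<not> 0 < fibre_sup (gtop G) (src G) h x"
  proof
    assume "0 < fibre_sup (gtop G) (src G) h x"
    then obtain g where "g \<in> arrows G" "src G g = x" "0 < h g"
      using less_fibre_sup_iff[of "gtop G" h 0 "src G" x] h1 by (auto simp: arrows_def)
    moreover have "l g \<le> T" using h0[of g] \<open>0 < h g\<close> \<open>g \<in> arrows G\<close> by fastforce
    ultimately show False using False by (auto simp: fibre_def)
  qed
  moreover have "0 \<le> fibre_sup (gtop G) (src G) h x"
    using h1 by (intro fibre_sup_bounds) (auto simp: arrows_def)
  ultimately show ?thesis by simp
qed

text \<open>A partition of unity subordinate to the charts of the ball splits \<open>F\<close> into
  pieces whose fibre sums are fibre suprema, and those are continuous.\<close>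

lemma continuous_fsum:
  assumes F: "continuous_map (gtop G) euclideanreal F" and F1: "\<And>g. g \<in> arrows G \<Longrightarrow> F g \<in> {0..1}"
    and F0: "\<And>g. g \<in> arrows G \<Longrightarrow> T < l g \<Longrightarrow> F g = 0"
  shows "continuous_map (unit_space G) euclideanreal (fsum F)"
proof -
  from ball_bump_cover[of T]
  obtain D V and f :: "'a \<Rightarrow> 'a \<Rightarrow> real" where D: "finite D"
    and inj: "\<forall>v \<in> D. inj_on (src G) (V v)"
    and "\<forall>v \<in> D. continuous_map (gtop G) euclideanreal (f v)"
    "\<forall>v \<in> D. \<forall>g \<in> arrows G. f v g \<in> {0..1}"
    "\<forall>v \<in> D. \<forall>g \<in> arrows G - V v. f v g = 0"
    "\<forall>g \<in> {g \<in> arrows G. l g \<le> T}. \<exists>v \<in> D. 1/2 < f v g"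
    by (elim exE conjE)
  then have f: "\<And>v. v \<in> D \<Longrightarrow> continuous_map (gtop G) euclideanreal (f v)"
    "\<And>v g. v \<in> D \<Longrightarrow> g \<in> arrows G \<Longrightarrow> f v g \<in> {0..1}"
    "\<And>v g. v \<in> D \<Longrightarrow> g \<in> arrows G \<Longrightarrow> g \<notin> V v \<Longrightarrow> f v g = 0"
    "\<And>g. g \<in> arrows G \<Longrightarrow> l g \<le> T \<Longrightarrow> \<exists>v \<in> D. 1/2 < f v g"
    by blast+
  \<comment> \<open>On the ball some bump exceeds \<open>1/2\<close>, so there \<open>d\<close> is
    the plain sum of the bumps; the maximum only keeps the denominator positive elsewhere.\<close>
  define d where "d g = max (1/2) (\<Sum>v \<in> D. f v g)" for g
  define h where "h v g = F g * f v g / d g" for v g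
  have dpos: "0 < d g" for g by (simp add: d_def max_def)
  have f_le_d: "f v g \<le> d g" if "v \<in> D" "g \<in> arrows G" for v g
    using member_le_sum[of v D "\<lambda>v. f v g"] f(2) that D by (fastforce simp: d_def)
  have h1: "h v g \<in> {0..1}" if "v \<in> D" "g \<in> arrows G" for v g
  proof -
    have "F g * f v g \<le> 1 * d g"
      using F1[of g] f(2)[of v g] f_le_d[of v g] that by (intro mult_mono) auto
    moreover have "0 \<le> F g * f v g" using F1[of g] f(2)[of v g] that by auto
    ultimately show ?thesis using dpos[of g] by (simp add: h_def divide_le_eq)
  qed
  have h0: "h v g = 0" if "v \<in> D" "g \<in> arrows G" "g \<notin> V v \<or> T < l g" for v g
    using that F0[of g] f(3)[of v g] by (auto simp: h_def)
  have hc: "continuous_map (gtop G) euclideanreal (h v)" if "v \<in> D" for v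
    unfolding h_def d_def
    by (intro continuous_map_real_divide continuous_map_real_mult continuous_map_real_max
        continuous_map_sum F f(1) D that continuous_map_canonical_const) (simp_all add: max_def)
  have "continuous_map (unit_space G) euclideanreal (fibre_sup (gtop G) (src G) (h v))" if "v \<in> D" for v
    using h1[OF that] h0[OF that]
    by (intro continuous_map_fibre_sup open_src continuous_src Hausdorff_units hc[OF that]
        compactin_superlevel[of _ T]) (auto simp: arrows_def)
  then have "continuous_map (unit_space G) euclideanreal
      (\<lambda>x. \<Sum>v \<in> D. fibre_sup (gtop G) (src G) (h v) x)"
    by (intro continuous_map_sum D) auto
  moreover have "(\<Sum>v \<in> D. fibre_sup (gtop G) (src G) (h v) x) = fsum F x" for x
  proof -
    have "(\<Sum>v \<in> D. fibre_sup (gtop G) (src G) (h v) x) = (\<Sum>v \<in> D. sum (h v) (fibre T x))"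
    proof (rule sum.cong[OF refl])
      fix v assume "v \<in> D"
      then show "fibre_sup (gtop G) (src G) (h v) x = sum (h v) (fibre T x)"
        using sum_fibre_eq_fibre_sup[of "V v" "h v" T x] inj h1 h0 by simp
    qed
    also have "\<dots> = (\<Sum>g \<in> fibre T x. \<Sum>v \<in> D. h v g)" by (rule sum.swap)
    also have "\<dots> = (\<Sum>g \<in> fibre T x. F g)"
    proof (rule sum.cong[OF refl])
      fix g assume "g \<in> fibre T x"
      then have g: "g \<in> arrows G" "l g \<le> T" by (auto simp: fibre_def)
      obtain v where v: "v \<in> D" "1/2 < f v g" using f(4)[OF g] by blast
      moreover have "f v g \<le> (\<Sum>v \<in> D. f v g)"
        using f(2) g v D by (intro member_le_sum) auto
      ultimately have d: "d g = (\<Sum>v \<in> D. f v g)" by (simp add: d_def)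
      have "(\<Sum>v \<in> D. h v g) = F g * (\<Sum>v \<in> D. f v g) / d g"
        by (simp add: h_def sum_distrib_left sum_divide_distrib)
      then show "(\<Sum>v \<in> D. h v g) = F g" using d dpos[of g] by simp
    qed
    finally show ?thesis by (simp add: fsum_eq[OF F0])
  qed
  ultimately show ?thesis by simp
qed

section \<open>The fibred product of the source map with itself\<close>

definition pairs :: "('a \<times> 'a) topology" where
  "pairs = subtopology (prod_topology (gtop G) (gtop G)) {(g, b). src G g = src G b}"

lemma topspace_pairs:
  "topspace pairs = {(g, b). g \<in> arrows G \<and> b \<in> arrows G \<and> src G g = src G b}"
  by (auto simp: pairs_def arrows_def)

text \<open>The projection is a pullback of the open map \<open>src\<close>, and openness survives
  pullback.\<close>

lemma open_fst_pairs: "open_map pairs (gtop G) fst"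
  unfolding open_map_def
proof (intro allI impI)
  fix W assume "openin pairs W"
  then obtain W' where W': "openin (prod_topology (gtop G) (gtop G)) W'"
    "W = W' \<inter> {(g, b). src G g = src G b}"
    by (auto simp: pairs_def openin_subtopology)
  have "\<exists>U. openin (gtop G) U \<and> g \<in> U \<and> U \<subseteq> fst ` W" if "g \<in> fst ` W" for g
  proof -
    obtain b where b: "(g, b) \<in> W'" "src G g = src G b"
    proof -
      obtain p where "p \<in> W" "g = fst p" using \<open>g \<in> fst ` W\<close> by blast
      then show thesis using W'(2) that[of "snd p"] by auto
    qed
    then obtain P Q where PQ: "openin (gtop G) P" "openin (gtop G) Q" "g \<in> P" "b \<in> Q" "P \<times> Q \<subseteq> W'"
      using W'(1)[unfolded openin_prod_topology_alt, rule_format, OF b(1)] by blast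
    define U where "U = P \<inter> {g \<in> topspace (gtop G). src G g \<in> src G ` Q}"
    have "openin (unit_space G) (src G ` Q)" using open_src PQ(2) by (simp add: open_map_def)
    then have "openin (gtop G) U"
      unfolding U_def using PQ(1) openin_continuous_map_preimage[OF continuous_src] by blast
    moreover have "g \<in> U" using PQ b openin_subset[OF PQ(1)] by (auto simp: U_def)
    moreover have "U \<subseteq> fst ` W" using PQ(5) W'(2) by (force simp: U_def)
    ultimately show ?thesis by blast
  qed
  then show "openin (gtop G) (fst ` W)" by (subst openin_subopen) blast
qed

lemma continuous_pairs_quotient:
  "continuous_map pairs (gtop G) (\<lambda>(g, b). g \<cdot> ginv G b)"
proof -
  let ?C = "subtopology (prod_topology (gtop G) (gtop G)) (composable G)"
  have "continuous_map pairs (prod_topology (gtop G) (gtop G)) (\<lambda>p. (fst p, ginv G (snd p)))"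
    unfolding pairs_def
    by (intro continuous_map_pairedI continuous_map_subtopology_fst
        continuous_map_compose[OF continuous_map_subtopology_snd continuous_inv, unfolded o_def])
  then have "continuous_map pairs ?C (\<lambda>p. (fst p, ginv G (snd p)))"
    by (rule continuous_map_into_subtopology)
      (auto simp: topspace_pairs composable_def inv_arrow rng_inv)
  from continuous_map_compose[OF this continuous_mult] show ?thesis
    by (simp add: o_def case_prod_unfold)
qed

end

subsection \<open>Kernels invariant under a bounded family of arrows\<close>

text \<open>The set \<open>Q\<close> contains the arrows with positive \<open>c\<close> and absorbs
  left multiplication by them, so it contains all their products; being bounded, it confines every
  chain to the ball of radius \<open>T\<close>. The bound \<open>c_rng\<close> lets a unit be added
  as a factor without loss.\<close>

locale chain_kernel = coarse_groupoid +
  fixes c :: "'a \<Rightarrow> real" and Q :: "'a set" and T :: real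
  assumes continuous_c: "continuous_map (gtop G) euclideanreal c"
    and c01: "g \<in> arrows G \<Longrightarrow> c g \<in> {0..1}"
    and c_inv: "g \<in> arrows G \<Longrightarrow> c (ginv G g) = c g"
    and c_rng: "g \<in> arrows G \<Longrightarrow> c g \<le> c (rng G g)"
    and Q_ball: "Q \<subseteq> {g \<in> arrows G. l g \<le> T}"
    and c_Q: "g \<in> arrows G \<Longrightarrow> 0 < c g \<Longrightarrow> g \<in> Q"
    and mult_Q: "a \<in> arrows G \<Longrightarrow> 0 < c a \<Longrightarrow> b \<in> Q \<Longrightarrow> src G a = rng G b \<Longrightarrow> a \<cdot> b \<in> Q"
begin

text \<open>\<open>chain n g\<close> is the supremum, over all factorisations of \<open>g\<close> into \<open>n + 1\<close> arrows, of the
  least value of \<open>c\<close> on a factor; the first factor is written as \<open>g \<cdot> b\<^sup>-\<^sup>1\<close>.\<close>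

primrec chain :: "nat \<Rightarrow> 'a \<Rightarrow> real" where
  "chain 0 = c"
| "chain (Suc n) = fibre_sup pairs fst (\<lambda>(g, b). min (c (g \<cdot> ginv G b)) (chain n b))"

lemma quotient_arrow:
  assumes "g \<in> arrows G" "b \<in> arrows G" "src G g = src G b"
  shows "g \<cdot> ginv G b \<in> arrows G" "src G (g \<cdot> ginv G b) = rng G b" "rng G (g \<cdot> ginv G b) = rng G g"
  using assms by (simp_all add: mult_closed inv_arrow rng_inv src_inv)

abbreviation link :: "nat \<Rightarrow> 'a \<times> 'a \<Rightarrow> real" where
  "link n \<equiv> \<lambda>(g, b). min (c (g \<cdot> ginv G b)) (chain n b)"

lemma link_le_1:
  "p \<in> topspace pairs \<Longrightarrow> link n p \<le> 1"
  using c01[OF quotient_arrow(1)] by (auto simp: topspace_pairs min_le_iff_disj)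

lemma chain01: "g \<in> arrows G \<Longrightarrow> chain n g \<in> {0..1}"
proof (cases n)
  case (Suc m)
  then show ?thesis using fibre_sup_bounds[of pairs "link m" fst g, OF link_le_1] by simp
qed (use c01 in simp)

lemma less_chain_Suc_iff:
  assumes "0 \<le> t"
  shows "t < chain (Suc n) g \<longleftrightarrow> (\<exists>b. g \<in> arrows G \<and> b \<in> arrows G \<and> src G g = src G b \<and>
    t < c (g \<cdot> ginv G b) \<and> t < chain n b)"
  using less_fibre_sup_iff[of pairs "link n" t fst g, OF link_le_1 assms]
  by (auto simp: topspace_pairs)

text \<open>A positive chain value at \<open>g\<close> splits off a first factor with positive
  \<open>c\<close> and leaves a positive chain value on the remainder, so induction and
  \<open>mult_Q\<close> keep the product in \<open>Q\<close>.\<close>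

lemma chain_pos_Q: "g \<in> arrows G \<Longrightarrow> 0 < chain n g \<Longrightarrow> g \<in> Q"
proof (induction n arbitrary: g)
  case 0
  then show ?case by (simp add: c_Q)
next
  case (Suc n)
  then obtain b where b: "b \<in> arrows G" "src G g = src G b" "0 < c (g \<cdot> ginv G b)" "0 < chain n b"
    using less_chain_Suc_iff[of 0 n g] by auto
  then have "(g \<cdot> ginv G b) \<cdot> b \<in> Q"
    using Suc.IH[of b] quotient_arrow[OF Suc.prems(1) b(1,2)] by (intro mult_Q) auto
  then show ?case using mult_inv_cancel_right'[OF Suc.prems(1) b(1,2)] by simp
qed

lemma chain_zero: "g \<in> arrows G \<Longrightarrow> T < l g \<Longrightarrow> chain n g = 0"
  using chain_pos_Q[of g n] chain01[of g n] Q_ball by fastforce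

lemma continuous_chain: "continuous_map (gtop G) euclideanreal (chain n)"
proof (induction n)
  case 0
  then show ?case by (simp add: continuous_c)
next
  case (Suc n)
  have contF: "continuous_map pairs euclideanreal (link n)"
  proof -
    have "continuous_map pairs euclideanreal (\<lambda>p. c (fst p \<cdot> ginv G (snd p)))"
      using continuous_map_compose[OF continuous_pairs_quotient continuous_c]
      by (simp add: o_def case_prod_unfold)
    moreover have "continuous_map pairs euclideanreal (\<lambda>p. chain n (snd p))"
      using continuous_map_compose[OF continuous_map_subtopology_snd Suc.IH]
      by (simp add: o_def pairs_def)
    ultimately show ?thesis
      unfolding case_prod_unfold by (rule continuous_map_real_min)
  qed
  have cpt: "compactin pairs {p \<in> topspace pairs. t \<le> link n p}" if "0 < t" for t
  proof -
    let ?B = "\<lambda>T. {g \<in> arrows G. l g \<le> T}"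
    \<comment> \<open>If \<open>link n\<close> is positive at \<open>(g, b)\<close>, both
      \<open>g \<cdot> ginv G b\<close> and \<open>b\<close> lie in \<open>Q\<close>, so their
      product \<open>g\<close> has length at most \<open>2 * T\<close>.\<close>
    let ?P = "(?B (2 * T) \<times> ?B T) \<inter> topspace pairs"
    have cl: "closedin (prod_topology (gtop G) (gtop G))
        {p \<in> topspace (prod_topology (gtop G) (gtop G)). src G (fst p) = src G (snd p)}"
      by (intro closedin_continuous_maps_eq[OF Hausdorff_units]
          continuous_map_compose[OF continuous_map_fst continuous_src, unfolded o_def]
          continuous_map_compose[OF continuous_map_snd continuous_src, unfolded o_def])
    have "compactin (prod_topology (gtop G) (gtop G)) (?B (2 * T) \<times> ?B T)"
      by (simp add: compactin_Times compactin_ball)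
    from closed_Int_compactin[OF cl this]
    have "compactin (prod_topology (gtop G) (gtop G)) ?P"
      by (rule back_subst[of "compactin _"]) (auto simp: topspace_pairs arrows_def)
    then have "compactin pairs ?P"
      by (auto simp: pairs_def compactin_subtopology)
    moreover have "{p \<in> topspace pairs. t \<le> link n p} \<subseteq> ?P"
    proof
      fix p assume "p \<in> {p \<in> topspace pairs. t \<le> link n p}"
      moreover obtain g b where p: "p = (g, b)" by (cases p)
      ultimately have gb: "(g, b) \<in> topspace pairs" "t \<le> c (g \<cdot> ginv G b)" "t \<le> chain n b"
        by auto
      then have arr: "g \<in> arrows G" "b \<in> arrows G" "src G g = src G b" by (auto simp: topspace_pairs)
      note q = quotient_arrow[OF arr]
      have "0 < c (g \<cdot> ginv G b)" "0 < chain n b" using gb \<open>0 < t\<close> by auto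
      then have "l (g \<cdot> ginv G b) \<le> T" "l b \<le> T"
        using c_Q[OF q(1)] chain_pos_Q[OF arr(2)] Q_ball by blast+
      moreover have "l g \<le> l (g \<cdot> ginv G b) + l b"
        using length_mult[OF q(1) arr(2) q(2)] mult_inv_cancel_right'[OF arr] by simp
      ultimately show "p \<in> ?P" unfolding p using arr gb(1) by auto
    qed
    ultimately show ?thesis using closed_compactin closedin_superlevel[OF contF] by blast
  qed
  have "continuous_map pairs (gtop G) fst"
    by (simp add: pairs_def continuous_map_subtopology_fst)
  then show ?case
    unfolding chain.simps
    by (intro continuous_map_fibre_sup open_fst_pairs Hausdorff contF link_le_1 cpt)
qed

text \<open>The first factor of any factorisation has the same range as \<open>g\<close>, and by
  \<open>c_rng\<close> its value is at most \<open>c (rng G g)\<close>.\<close>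

lemma chain_le_rng: "g \<in> arrows G \<Longrightarrow> chain n g \<le> c (rng G g)"
proof (cases n)
  case (Suc m)
  assume g: "g \<in> arrows G"
  show ?thesis
  proof (rule ccontr)
    assume "\<not> ?thesis"
    then have "c (rng G g) < chain (Suc m) g" by (simp only: Suc not_le)
    then obtain b where b: "b \<in> arrows G" "src G g = src G b" "c (rng G g) < c (g \<cdot> ginv G b)"
      using less_chain_Suc_iff[of "c (rng G g)" m g] c01[OF rng_in_arrows[OF g]] by auto
    then show False
      using c_rng[OF quotient_arrow(1)[OF g b(1,2)]] quotient_arrow(3)[OF g b(1,2)] by simp
  qed
qed (simp add: c_rng)

text \<open>Prepending the unit \<open>rng G g\<close> costs nothing, since by
  \<open>chain_le_rng\<close> its \<open>c\<close>-value is at least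
  \<open>chain n g\<close>.\<close>

lemma chain_le_Suc:
  assumes g: "g \<in> arrows G"
  shows "chain n g \<le> chain (Suc n) g"
proof (rule ccontr)
  assume "\<not> ?thesis"
  then have lt: "chain (Suc n) g < chain n g" by (simp only: not_le)
  moreover have "0 \<le> chain (Suc n) g" using chain01[OF g, of "Suc n"] by (simp only: atLeastAtMost_iff)
  moreover have "chain (Suc n) g < c (g \<cdot> ginv G g)"
    using lt chain_le_rng[OF g, of n] mult_inv[OF g] by (simp del: chain.simps)
  ultimately have "chain (Suc n) g < chain (Suc n) g"
    using g by (subst less_chain_Suc_iff) blast+
  then show False by simp
qed

text \<open>For a fixed level \<open>t\<close>, the arrows of a source fibre with
  \<open>chain n\<close> above \<open>t\<close> form an increasing family obeying a recursion that
  does not depend on \<open>n\<close>, inside a set of at most \<open>N\<close> elements. Since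
  \<open>N\<close> is uniform in the fibre and the level, one index works everywhere.\<close>

lemma chain_stable: "\<exists>N. \<forall>g \<in> arrows G. chain (Suc N) g = chain N g"
proof -
  obtain N where N: "\<And>x. finite (fibre T x) \<and> card (fibre T x) \<le> N"
    using fibre_bound[of T] by metis
  have "chain (Suc N) g \<le> chain N g" if g: "g \<in> arrows G" for g
  proof (rule ccontr)
    assume "\<not> ?thesis"
    \<comment> \<open>With this level, \<open>g\<close> would lie in \<open>A (Suc N)\<close> but
      not in \<open>A N\<close>, contradicting stability.\<close>
    define t where "t = chain N g"
    have lt: "t < chain (Suc N) g" using \<open>\<not> _\<close> by (simp only: not_le t_def)
    have t0: "0 \<le> t" using chain01[OF g] by (simp add: t_def)
    define A where "A n = {h \<in> arrows G. src G h = src G g \<and> t < chain n h}" for n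
    define \<Gamma> where "\<Gamma> S = {h \<in> arrows G. src G h = src G g \<and> (\<exists>b \<in> S. t < c (h \<cdot> ginv G b))}" for S
    have "A (Suc N) = A N"
    proof (rule stable_chain[where B = "fibre T (src G g)"])
      show "A n \<subseteq> A (Suc n)" for n
        using chain_le_Suc[of _ n] by (auto simp: A_def simp del: chain.simps intro: less_le_trans)
      show "A (Suc n) = \<Gamma> (A n)" for n
        unfolding A_def \<Gamma>_def less_chain_Suc_iff[OF t0] by auto
      show "A n \<subseteq> fibre T (src G g)" for n
        using chain_pos_Q[of _ n] Q_ball t0 by (fastforce simp: A_def fibre_def)
    qed (use N in auto)
    moreover have "g \<in> A (Suc N)" using g lt by (simp only: A_def mem_Collect_eq simp_thms)
    moreover have "g \<notin> A N" by (simp add: A_def t_def)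
    ultimately show False by simp
  qed
  then show ?thesis using chain_le_Suc order_antisym by metis
qed

text \<open>A factorisation of \<open>g\<close> extended by \<open>k\<close> as last factor is one
  of \<open>g \<cdot> k\<close> with one more factor, and all values remain above
  \<open>t\<close>.\<close>

lemma less_chain_mult_right:
  assumes "0 \<le> t" "k \<in> arrows G" "t < c k"
  shows "g \<in> arrows G \<Longrightarrow> src G g = rng G k \<Longrightarrow> t < chain n g \<Longrightarrow> t < chain (Suc n) (g \<cdot> k)"
proof (induction n arbitrary: g)
  case 0
  then have "g \<cdot> k \<in> arrows G" "src G (g \<cdot> k) = src G k" "(g \<cdot> k) \<cdot> ginv G k = g"
    using assms mult_closed mult_inv_cancel_right by auto
  then show ?case
    unfolding less_chain_Suc_iff[OF assms(1)] using 0 assms by (intro exI[of _ k]) simp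
next
  case (Suc n)
  then obtain b where b: "b \<in> arrows G" "src G g = src G b" "t < c (g \<cdot> ginv G b)" "t < chain n b"
    unfolding less_chain_Suc_iff[OF assms(1)] by blast
  note q = quotient_arrow[OF Suc.prems(1) b(1,2)]
  have sb: "src G b = rng G k" using b Suc.prems by simp
  note bk = mult_closed[OF b(1) assms(2) sb]
  \<comment> \<open>Replacing the remainder \<open>b\<close> by \<open>b \<cdot> k\<close> leaves
    the first factor \<open>g \<cdot> ginv G b\<close> unchanged.\<close>
  have "g \<cdot> k = ((g \<cdot> ginv G b) \<cdot> b) \<cdot> k"
    using mult_inv_cancel_right'[OF Suc.prems(1) b(1,2)] by simp
  also have "\<dots> = (g \<cdot> ginv G b) \<cdot> (b \<cdot> k)"
    using assoc[OF q(1) b(1) assms(2) q(2) sb] .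
  finally have "(g \<cdot> k) \<cdot> ginv G (b \<cdot> k) = g \<cdot> ginv G b"
    using mult_inv_cancel_right[OF q(1) bk(1)] q(2) bk(3) by simp
  moreover have "t < chain (Suc n) (b \<cdot> k)" using Suc.IH[OF b(1) sb b(4)] .
  ultimately show ?case
    using mult_closed[OF Suc.prems(1) assms(2) Suc.prems(2)] bk b(3)
    unfolding less_chain_Suc_iff[OF assms(1), of "Suc n"] by (intro exI[of _ "b \<cdot> k"]) simp
qed

text \<open>The kernel is \<open>chain N\<close> at the stable index. Appending \<open>k\<close>
  with \<open>c k = 1\<close> does not lower the value, and the extra factor is absorbed by
  stability; the reverse inequality follows by appending \<open>ginv G k\<close>, where
  \<open>c_inv\<close> gives the same value \<open>1\<close>.\<close>

lemma exists_invariant_kernel: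
  "\<exists>w :: 'a \<Rightarrow> real. continuous_map (gtop G) euclideanreal w \<and> (\<forall>g \<in> arrows G. w g \<in> {0..1}) \<and>
    (\<forall>g \<in> arrows G. T < l g \<longrightarrow> w g = 0) \<and> (\<forall>g \<in> arrows G. c g \<le> w g) \<and>
    (\<forall>g \<in> arrows G. \<forall>k \<in> arrows G. src G g = rng G k \<and> c k = 1 \<longrightarrow> w (g \<cdot> k) = w g)"
proof -
  obtain N where N: "\<And>g. g \<in> arrows G \<Longrightarrow> chain (Suc N) g = chain N g"
    using chain_stable by blast
  have le: "chain N g \<le> chain N (g \<cdot> k)"
    if gk: "g \<in> arrows G" "k \<in> arrows G" "src G g = rng G k" "c k = 1" for g k
  proof (rule ccontr)
    assume "\<not> ?thesis"
    then have lt: "chain N (g \<cdot> k) < chain N g" by simp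
    have arr: "g \<cdot> k \<in> arrows G" using mult_closed[OF gk(1,2,3)] by simp
    have "chain N (g \<cdot> k) < chain (Suc N) (g \<cdot> k)"
    proof (rule less_chain_mult_right[OF _ gk(2) _ gk(1,3) lt])
      show "0 \<le> chain N (g \<cdot> k)" using chain01[OF arr] by simp
      show "chain N (g \<cdot> k) < c k" using lt chain01[OF gk(1), of N] gk(4) by simp
    qed
    then show False using N[OF arr] by (simp only: less_irrefl)
  qed
  have "chain N (g \<cdot> k) = chain N g"
    if gk: "g \<in> arrows G" "k \<in> arrows G" "src G g = rng G k" "c k = 1" for g k
  proof (rule order_antisym)
    note m = mult_closed[OF gk(1,2,3)]
    have "chain N (g \<cdot> k) \<le> chain N ((g \<cdot> k) \<cdot> ginv G k)"
      using m gk by (intro le) (simp_all add: inv_arrow rng_inv c_inv)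
    then show "chain N (g \<cdot> k) \<le> chain N g" using mult_inv_cancel_right[OF gk(1,2,3)] by simp
  qed (use le gk in blast)
  moreover have "c g \<le> chain n g" if "g \<in> arrows G" for g n
  proof (induction n)
    case (Suc n)
    then show ?case using chain_le_Suc[OF that, of n] by linarith
  qed simp
  ultimately show ?thesis
    by (intro exI[of _ "chain N"] conjI ballI impI continuous_chain chain01 chain_zero) auto
qed

end

subsection \<open>The kernel attached to one member of a cover\<close>

text \<open>Here \<open>\<rho>\<close> is a plateau function positive only inside \<open>U\<close>,
  \<open>r\<close> is the scale at which it is spread, and \<open>L\<close> bounds the arrows tested
  for invariance. The radius \<open>4 * r\<close> leaves room for an arrow shorter than
  \<open>2 * L\<close> flanked by two arrows shorter than \<open>r\<close>.\<close>

locale cutoff = coarse_groupoid +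
  fixes \<rho> :: "'a \<Rightarrow> real" and U H :: "'a set" and r L :: real
  assumes continuous_rho: "continuous_map (unit_space G) euclideanreal \<rho>"
    and rho01: "x \<in> units G \<Longrightarrow> \<rho> x \<in> {0..1}"
    and rho_pos: "x \<in> units G \<Longrightarrow> 0 < \<rho> x \<Longrightarrow> x \<in> U"
    and subgroupoid_H: "subgroupoid G H"
    and precompact_H: "precompactin (gtop G) H"
    and small_H: "g \<in> arrows G \<Longrightarrow> l g < 4 * r \<Longrightarrow> src G g \<in> U \<Longrightarrow> rng G g \<in> U \<Longrightarrow> g \<in> H"
    and L_pos: "0 < L" and L_le: "4 * L \<le> r"
begin

lemma r_pos: "0 < r"
  using L_pos L_le by linarith

definition bump :: "'a \<Rightarrow> real" where
  "bump g = max 0 (\<rho> (rng G g) - l g / r)"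

text \<open>This is a sup-convolution: on the units, the least majorant of \<open>\<rho>\<close>
  that is \<open>1/r\<close>-Lipschitz along arrows.\<close>

definition \<phi> :: "'a \<Rightarrow> real" where
  "\<phi> = fibre_sup (gtop G) (src G) bump"

lemma bump01: "g \<in> arrows G \<Longrightarrow> bump g \<in> {0..1}"
  using rho01[OF rng_unit, of g] length_nonneg[of g] r_pos
  by (auto simp: bump_def intro: order_trans[of _ "\<rho> (rng G g)"])

lemma bump_le_1: "g \<in> topspace (gtop G) \<Longrightarrow> bump g \<le> 1"
  using bump01 by (simp add: arrows_def)

lemma phi01: "\<phi> x \<in> {0..1}"
  using fibre_sup_bounds[of "gtop G" bump "src G" x] bump_le_1 by (simp add: \<phi>_def)

lemma less_phi_iff: "0 \<le> t \<Longrightarrow> t < \<phi> x \<longleftrightarrow> (\<exists>g \<in> arrows G. src G g = x \<and> t < bump g)"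
  using less_fibre_sup_iff[of "gtop G" bump t "src G" x] bump_le_1 by (simp add: \<phi>_def arrows_def)

lemma bump_le_phi: "g \<in> arrows G \<Longrightarrow> bump g \<le> \<phi> (src G g)"
  using fibre_sup_ge[of "gtop G" bump g "src G"] bump_le_1 by (simp add: \<phi>_def arrows_def)

lemma bump_zero:
  assumes "g \<in> arrows G" "r < l g"
  shows "bump g = 0"
proof -
  have "1 < l g / r" using assms r_pos by simp
  then show ?thesis using rho01[OF rng_unit[OF assms(1)]] by (simp add: bump_def)
qed

lemma continuous_bump: "continuous_map (gtop G) euclideanreal bump"
  unfolding bump_def using r_pos
  by (intro continuous_map_real_max continuous_map_diff continuous_map_real_divide
      continuous_map_canonical_const continuous_length continuous_comp_rng continuous_rho) simp

lemma continuous_phi: "continuous_map (unit_space G) euclideanreal \<phi>"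
  unfolding \<phi>_def
  by (intro continuous_map_fibre_sup open_src continuous_src Hausdorff_units continuous_bump bump_le_1
      compactin_superlevel[of _ r] bump_zero)

definition near :: "'a \<Rightarrow> 'a set" where
  "near x = {h \<in> arrows G. src G h = x \<and> l h < r \<and> rng G h \<in> U}"

text \<open>A positive bump at \<open>g\<close> means
  \<open>l g / r < \<rho> (rng G g) \<le> 1\<close>, so \<open>g\<close> is shorter than
  \<open>r\<close> and ends in \<open>U\<close>.\<close>

lemma phi_pos_near:
  assumes "0 < \<phi> x" shows "near x \<noteq> {}"
proof -
  obtain g where g: "g \<in> arrows G" "src G g = x" "0 < bump g"
    using assms less_phi_iff[of 0 x] by auto
  then have *: "l g / r < \<rho> (rng G g)" by (simp add: bump_def)
  moreover have "0 \<le> l g / r" using length_nonneg[OF g(1)] r_pos by simp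
  ultimately have "0 < \<rho> (rng G g)" by linarith
  then have "rng G g \<in> U" using rho_pos rng_unit g by blast
  moreover have "l g / r < 1" using * rho01[OF rng_unit[OF g(1)]] by simp
  ultimately show ?thesis using g r_pos by (auto simp: near_def)
qed

lemma rho_le_phi: "x \<in> units G \<Longrightarrow> \<rho> x \<le> \<phi> x"
  using bump_le_phi[of x] units_subset by (auto simp: bump_def units_def length_unit)

text \<open>An arrow \<open>g\<close> competing at \<open>rng G k\<close> yields
  \<open>g \<cdot> k\<close> competing at \<open>src G k\<close>, at an extra cost of at most
  \<open>l k / r\<close>.\<close>

lemma phi_step:
  assumes k: "k \<in> arrows G"
  shows "\<phi> (rng G k) \<le> \<phi> (src G k) + l k / r"
proof (rule ccontr)
  assume "\<not> ?thesis"
  then have lt: "\<phi> (src G k) + l k / r < \<phi> (rng G k)" by simp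
  have nn: "0 \<le> \<phi> (src G k) + l k / r"
    using phi01[of "src G k"] length_nonneg[OF k] r_pos by simp
  obtain g where g: "g \<in> arrows G" "src G g = rng G k" "\<phi> (src G k) + l k / r < bump g"
    using lt less_phi_iff[OF nn] by auto
  note gk = mult_closed[OF g(1) k g(2)]
  have "l (g \<cdot> k) / r \<le> l g / r + l k / r"
    using length_mult[OF g(1) k g(2)] r_pos by (simp add: add_divide_distrib[symmetric] divide_right_mono)
  moreover have "bump g = \<rho> (rng G g) - l g / r" using g(3) nn by (simp add: bump_def max_def split: if_splits)
  moreover have "\<rho> (rng G g) - l (g \<cdot> k) / r \<le> \<phi> (src G k)"
    using bump_le_phi[OF gk(1)] gk(2,3) by (simp add: bump_def)
  ultimately show False using g(3) by linarith
qed

lemma phi_lipschitz: "k \<in> arrows G \<Longrightarrow> \<bar>\<phi> (src G k) - \<phi> (rng G k)\<bar> \<le> l k / r"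
  using phi_step[of k] phi_step[of "ginv G k"] by (simp add: inv_arrow rng_inv src_inv length_inv abs_le_iff)

text \<open>This is the function \<open>c\<close> fed to \<open>chain_kernel\<close>: it is
  \<open>1\<close> on arrows of length at most \<open>L\<close> with \<open>\<phi>\<close> at least
  \<open>1/4\<close> at both ends, and vanishes beyond length \<open>2 * L\<close> or where
  \<open>\<phi>\<close> vanishes at an end. Symmetry in the two ends makes it invariant under
  inversion.\<close>

definition cut :: "'a \<Rightarrow> real" where
  "cut g = min (min 1 (max 0 (2 - l g / L))) (min (4 * \<phi> (src G g)) (4 * \<phi> (rng G g)))"

lemma cut_pos:
  assumes "g \<in> arrows G" "0 < cut g"
  shows "l g < 2 * L" "near (src G g) \<noteq> {}" "near (rng G g) \<noteq> {}"
proof -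
  have pos: "0 < 2 - l g / L" "0 < \<phi> (src G g)" "0 < \<phi> (rng G g)"
    using assms(2) by (auto simp: cut_def less_max_iff_disj)
  then show "l g < 2 * L" using L_pos by (simp add: pos_divide_less_eq)
  show "near (src G g) \<noteq> {}" "near (rng G g) \<noteq> {}" using pos phi_pos_near by blast+
qed

text \<open>This is the set \<open>Q\<close> for \<open>chain_kernel\<close>. Only some pair of
  connecting arrows \<open>h\<close>, \<open>h'\<close> is demanded, a condition that bounds lengths
  and passes to products.\<close>

definition transported :: "'a set" where
  "transported = {g \<in> arrows G. \<exists>h \<in> near (src G g). \<exists>h' \<in> near (rng G g). (h' \<cdot> g) \<cdot> ginv G h \<in> H}"

lemma conj_arrow:
  assumes "g \<in> arrows G" "h \<in> arrows G" "src G h = src G g" "h' \<in> arrows G" "src G h' = rng G g"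
  shows "h' \<cdot> g \<in> arrows G" "src G (h' \<cdot> g) = src G h"
    "(h' \<cdot> g) \<cdot> ginv G h \<in> arrows G" "src G ((h' \<cdot> g) \<cdot> ginv G h) = rng G h"
    "rng G ((h' \<cdot> g) \<cdot> ginv G h) = rng G h'"
  using assms by (simp_all add: mult_closed inv_arrow rng_inv src_inv)

text \<open>The conjugate has length below \<open>r + 2 * L + r\<close>, which is at most
  \<open>4 * r\<close>, and both its ends lie in \<open>U\<close>. That every choice of
  \<open>h\<close> and \<open>h'\<close> works is what makes products manageable.\<close>

lemma cut_conj_in_H:
  assumes g: "g \<in> arrows G" "0 < cut g" and "h \<in> near (src G g)" "h' \<in> near (rng G g)"
  shows "(h' \<cdot> g) \<cdot> ginv G h \<in> H"
proof -
  have h: "h \<in> arrows G" "src G h = src G g" "l h < r" "rng G h \<in> U"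
    "h' \<in> arrows G" "src G h' = rng G g" "l h' < r" "rng G h' \<in> U"
    using assms by (auto simp: near_def)
  note c = conj_arrow[OF g(1) h(1,2,5,6)]
  have "l ((h' \<cdot> g) \<cdot> ginv G h) \<le> l (h' \<cdot> g) + l (ginv G h)"
    using c(1,2) h by (intro length_mult) (simp_all add: inv_arrow rng_inv)
  also have "\<dots> \<le> l h' + l g + l h"
    using length_mult[OF h(5) g(1) h(6)] by (simp add: length_inv[OF h(1)])
  also have "\<dots> < 4 * r" using h cut_pos(1)[OF g] L_le L_pos by linarith
  finally show ?thesis using c h by (intro small_H) simp_all
qed

text \<open>Undoing the conjugation adds at most \<open>2 * r\<close> to a length that is bounded on
  the precompact \<open>H\<close>.\<close>

lemma transported_ball: "\<exists>T. transported \<subseteq> {g \<in> arrows G. l g \<le> T}"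
proof -
  obtain M where M: "\<And>g. g \<in> H \<Longrightarrow> l g \<le> M"
    using bounded_on_precompact[OF precompact_H] by (auto simp: bdd_above_def)
  have "l g \<le> M + 2 * r" if "g \<in> transported" for g
  proof -
    obtain h h' where g: "g \<in> arrows G" and "h \<in> near (src G g)" "h' \<in> near (rng G g)"
      and H: "(h' \<cdot> g) \<cdot> ginv G h \<in> H"
      using \<open>g \<in> transported\<close> unfolding transported_def by blast
    then have h: "h \<in> arrows G" "src G h = src G g" "l h < r"
      "h' \<in> arrows G" "src G h' = rng G g" "l h' < r"
      by (auto simp: near_def)
    note c = conj_arrow[OF g h(1,2,4,5)]
    have "l (h' \<cdot> g) \<le> l ((h' \<cdot> g) \<cdot> ginv G h) + l h"
      using length_mult[OF c(3) h(1) c(4)] mult_inv_cancel_right'[OF c(1) h(1) c(2)] by simp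
    moreover have "l g \<le> l h' + l (h' \<cdot> g)"
      using length_mult[of "ginv G h'" "h' \<cdot> g"] mult_inv_cancel_left[OF h(4) g h(5)] h g c(1)
      by (simp add: inv_arrow src_inv length_inv mult_closed)
    ultimately show ?thesis using M[OF H] h by linarith
  qed
  moreover have "transported \<subseteq> arrows G" by (auto simp: transported_def)
  ultimately show ?thesis by blast
qed

text \<open>Two conjugates that use the same connecting arrow \<open>h'\<close> at the common unit
  compose inside the subgroupoid \<open>H\<close>, and \<open>h'\<close> cancels with its
  inverse.\<close>

lemma mult_transported:
  assumes a: "a \<in> arrows G" "0 < cut a" and b: "b \<in> transported" and ab: "src G a = rng G b"
  shows "a \<cdot> b \<in> transported"
proof -
  obtain h h' where barr: "b \<in> arrows G" and hn: "h \<in> near (src G b)" "h' \<in> near (rng G b)"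
    and bH: "(h' \<cdot> b) \<cdot> ginv G h \<in> H"
    using b unfolding transported_def by blast
  obtain h'' where h''n: "h'' \<in> near (rng G a)" using cut_pos(3)[OF a] by blast
  \<comment> \<open>\<open>cut_conj_in_H\<close> allows any near arrow, so the \<open>h'\<close>
    that came with \<open>b\<close> can be used for \<open>a\<close> as well.\<close>
  have aH: "(h'' \<cdot> a) \<cdot> ginv G h' \<in> H"
    using cut_conj_in_H[OF a, of h' h''] hn h''n ab by simp
  have h: "h \<in> arrows G" "src G h = src G b" "h' \<in> arrows G" "src G h' = rng G b"
    "h'' \<in> arrows G" "src G h'' = rng G a"
    using hn h''n by (auto simp: near_def)
  note cb = conj_arrow[OF barr h(1-4)]
  note ca = conj_arrow[OF a(1) h(3) _ h(5,6)]
  have sa: "src G h' = src G a" using h ab by simp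
  have m: "a \<cdot> b \<in> arrows G" "src G (a \<cdot> b) = src G b" "rng G (a \<cdot> b) = rng G a"
    using mult_closed[OF a(1) barr ab] by auto
  let ?p = "(h'' \<cdot> a) \<cdot> ginv G h'"
  have "?p \<cdot> ((h' \<cdot> b) \<cdot> ginv G h) = (?p \<cdot> (h' \<cdot> b)) \<cdot> ginv G h"
    using ca[OF sa] cb h mult_closed[OF h(3) barr h(4)]
    by (intro assoc[symmetric]) (simp_all add: inv_arrow rng_inv)
  also have "?p \<cdot> (h' \<cdot> b) = (?p \<cdot> h') \<cdot> b"
    using ca[OF sa] h barr by (intro assoc[symmetric]) simp_all
  also have "?p \<cdot> h' = h'' \<cdot> a"
    using mult_inv_cancel_right'[OF ca(1)[OF sa] h(3) ca(2)[OF sa]] .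
  also have "(h'' \<cdot> a) \<cdot> b = h'' \<cdot> (a \<cdot> b)"
    using assoc[OF h(5) a(1) barr h(6) ab] .
  finally have "(h'' \<cdot> (a \<cdot> b)) \<cdot> ginv G h = ?p \<cdot> ((h' \<cdot> b) \<cdot> ginv G h)" by simp
  moreover have "?p \<cdot> ((h' \<cdot> b) \<cdot> ginv G h) \<in> H"
  proof -
    have "src G ?p = rng G ((h' \<cdot> b) \<cdot> ginv G h)" using ca[OF sa] cb by simp
    then show ?thesis using subgroupoid_H aH bH by (simp add: subgroupoid_def)
  qed
  ultimately have "(h'' \<cdot> (a \<cdot> b)) \<cdot> ginv G h \<in> H" by simp
  moreover have "h \<in> near (src G (a \<cdot> b))" "h'' \<in> near (rng G (a \<cdot> b))"
    using m hn h''n by simp_all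
  ultimately show ?thesis using m(1) unfolding transported_def by blast
qed

lemma continuous_cut: "continuous_map (gtop G) euclideanreal cut"
  unfolding cut_def using L_pos
  by (intro continuous_map_real_min continuous_map_real_max continuous_map_diff
      continuous_map_real_divide continuous_map_real_mult_left continuous_map_canonical_const
      continuous_length continuous_comp_src continuous_comp_rng continuous_phi) simp

lemma cut_unit: "x \<in> units G \<Longrightarrow> cut x = min 1 (4 * \<phi> x)"
  by (simp add: cut_def units_def[of G] length_unit)

lemma exists_chain_kernel: "\<exists>T. chain_kernel G l cut transported T"
proof -
  obtain T where T: "transported \<subseteq> {g \<in> arrows G. l g \<le> T}" using transported_ball by blast
  have "chain_kernel_axioms G l cut transported T"
  proof
    show "cut g \<in> {0..1}" for g
      using phi01[of "src G g"] phi01[of "rng G g"] by (auto simp: cut_def)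
    show "cut (ginv G g) = cut g" if "g \<in> arrows G" for g
      using that by (simp add: cut_def src_inv rng_inv length_inv min.commute)
    show "cut g \<le> cut (rng G g)" if "g \<in> arrows G" for g
      unfolding cut_unit[OF rng_unit[OF that]] by (simp add: cut_def min_le_iff_disj)
    show "g \<in> transported" if g: "g \<in> arrows G" "0 < cut g" for g
    proof -
      obtain h h' where "h \<in> near (src G g)" "h' \<in> near (rng G g)" using cut_pos(2,3)[OF g] by blast
      then show ?thesis using cut_conj_in_H[OF g] g by (auto simp: transported_def)
    qed
  qed (use T continuous_cut mult_transported in auto)
  then show ?thesis using coarse_groupoid_axioms by (auto simp: chain_kernel_def)
qed

lemma cut_eq_1:
  assumes "k \<in> arrows G" "l k \<le> L" "1/4 \<le> \<phi> (src G k)" "1/4 \<le> \<phi> (rng G k)"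
  shows "cut k = 1"
proof -
  have "l k / L \<le> 1" using assms L_pos by simp
  then show ?thesis using assms by (simp add: cut_def)
qed

lemma exists_kernel:
  "\<exists>(w :: 'a \<Rightarrow> real) T. continuous_map (gtop G) euclideanreal w \<and> (\<forall>g \<in> arrows G. w g \<in> {0..1}) \<and>
    (\<forall>g \<in> arrows G. T < l g \<longrightarrow> w g = 0) \<and> (\<forall>x \<in> units G. 1/4 \<le> \<phi> x \<longrightarrow> w x = 1) \<and>
    (\<forall>g \<in> arrows G. \<forall>k \<in> arrows G. src G g = rng G k \<and> l k \<le> L \<and> 1/4 \<le> \<phi> (src G k) \<and>
      1/4 \<le> \<phi> (rng G k) \<longrightarrow> w (g \<cdot> k) = w g)"
proof -
  obtain T where "chain_kernel G l cut transported T" using exists_chain_kernel by blast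
  from chain_kernel.exists_invariant_kernel[OF this] obtain w :: "'a \<Rightarrow> real" where
    w: "continuous_map (gtop G) euclideanreal w" "\<forall>g \<in> arrows G. w g \<in> {0..1}"
    "\<forall>g \<in> arrows G. T < l g \<longrightarrow> w g = 0" "\<forall>g \<in> arrows G. cut g \<le> w g"
    "\<forall>g \<in> arrows G. \<forall>k \<in> arrows G. src G g = rng G k \<and> cut k = 1 \<longrightarrow> w (g \<cdot> k) = w g"
    by (elim exE conjE)
  have "w x = 1" if "x \<in> units G" "1/4 \<le> \<phi> x" for x
  proof -
    have "1 \<le> w x" "w x \<le> 1" using w(2,4) cut_unit[OF that(1)] that units_subset by force+
    then show ?thesis by simp
  qed
  then show ?thesis
    using w(1-3) w(5) cut_eq_1 by (intro exI[of _ w] exI[of _ T]) blast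
qed

end

section \<open>Translation of fibre sums\<close>

context coarse_groupoid
begin

text \<open>Right multiplication by \<open>k\<close> is a bijection from the fibre over
  \<open>rng G k\<close> onto the fibre over \<open>src G k\<close>, inverted by right
  multiplication by \<open>ginv G k\<close>.\<close>

lemma fsum_translate:
  assumes k: "k \<in> arrows G"
  shows "fsum F (src G k) = fsum (\<lambda>g. F (g \<cdot> k)) (rng G k)"
  unfolding fsum_def
proof (rule infsum_reindex_bij_betw[symmetric], rule bij_betw_byWitness[where f' = "\<lambda>g. g \<cdot> ginv G k"])
  show "\<forall>g \<in> {g \<in> arrows G. src G g = rng G k}. (g \<cdot> k) \<cdot> ginv G k = g"
    using k by (simp add: mult_inv_cancel_right)
  show "\<forall>g \<in> {g \<in> arrows G. src G g = src G k}. (g \<cdot> ginv G k) \<cdot> k = g"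
    using k by (simp add: mult_inv_cancel_right')
  show "(\<lambda>g. g \<cdot> k) ` {g \<in> arrows G. src G g = rng G k} \<subseteq> {g \<in> arrows G. src G g = src G k}"
    using k by (auto simp: mult_closed)
  show "(\<lambda>g. g \<cdot> ginv G k) ` {g \<in> arrows G. src G g = src G k} \<subseteq> {g \<in> arrows G. src G g = rng G k}"
    using k by (auto simp: mult_closed inv_arrow rng_inv src_inv)
qed

lemma fsum_cong: "(\<And>g. g \<in> arrows G \<Longrightarrow> src G g = x \<Longrightarrow> F g = F' g) \<Longrightarrow> fsum F x = fsum F' x"
  unfolding fsum_def by (rule infsum_cong) simp

end

context cutoff
begin

text \<open>The factor \<open>2 * \<phi> - 1\<close> keeps \<open>\<phi>\<close> above \<open>1/4\<close> at both ends of an arrow of length at most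
  \<open>L\<close> as soon as the weight is nonzero at one end.\<close>

definition weight :: "'a \<Rightarrow> real" where
  "weight x = max 0 (2 * \<phi> x - 1)"

text \<open>Where the weight is positive the unit itself contributes \<open>w x = 1\<close>, so the
  fibre sum is at least \<open>1\<close> and normalising makes it exactly \<open>1\<close>.\<close>

lemma exists_normalised_kernel:
  "\<exists>(\<nu> :: 'a \<Rightarrow> real) T. continuous_map (gtop G) euclideanreal \<nu> \<and> (\<forall>g \<in> arrows G. \<nu> g \<in> {0..1}) \<and>
    (\<forall>g \<in> arrows G. T < l g \<longrightarrow> \<nu> g = 0) \<and>
    (\<forall>x \<in> units G. fsum \<nu> x \<le> 1) \<and> (\<forall>x \<in> units G. 0 < weight x \<longrightarrow> fsum \<nu> x = 1) \<and>
    (\<forall>g \<in> arrows G. \<forall>k \<in> arrows G. src G g = rng G k \<and> l k \<le> L \<and>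
      (0 < weight (src G k) \<or> 0 < weight (rng G k)) \<longrightarrow> \<nu> (g \<cdot> k) = \<nu> g)"
proof -
  from exists_kernel obtain w :: "'a \<Rightarrow> real" and T where
    w: "continuous_map (gtop G) euclideanreal w" "\<forall>g \<in> arrows G. w g \<in> {0..1}"
    "\<forall>g \<in> arrows G. T < l g \<longrightarrow> w g = 0" "\<forall>x \<in> units G. 1/4 \<le> \<phi> x \<longrightarrow> w x = 1"
    "\<forall>g \<in> arrows G. \<forall>k \<in> arrows G. src G g = rng G k \<and> l k \<le> L \<and> 1/4 \<le> \<phi> (src G k) \<and>
      1/4 \<le> \<phi> (rng G k) \<longrightarrow> w (g \<cdot> k) = w g"
    by (elim exE conjE)
  define \<nu> where "\<nu> g = w g / max 1 (fsum w (src G g))" for g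
  have w_fsum: "fsum w x = sum w (fibre T x)" for x
    using w(3) by (intro fsum_eq) blast
  have \<nu>_fsum: "fsum \<nu> x = fsum w x / max 1 (fsum w x)" for x
  proof -
    have "fsum \<nu> x = sum \<nu> (fibre T x)"
      using w(3) by (intro fsum_eq) (simp add: \<nu>_def)
    also have "\<dots> = (\<Sum>g \<in> fibre T x. w g / max 1 (fsum w x))"
      by (intro sum.cong refl) (simp add: \<nu>_def fibre_def)
    finally show ?thesis by (simp add: w_fsum sum_divide_distrib)
  qed
  have inv: "\<nu> (g \<cdot> k) = \<nu> g"
    if g: "g \<in> arrows G" and k: "k \<in> arrows G" "src G g = rng G k" "l k \<le> L"
      and pos: "0 < weight (src G k) \<or> 0 < weight (rng G k)" for g k
  proof -
    \<comment> \<open>As \<open>4 * L \<le> r\<close>, \<open>\<phi>\<close> changes by at most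
      \<open>1/4\<close> along \<open>k\<close>; being above \<open>1/2\<close> at one end, it is at
      least \<open>1/4\<close> at both.\<close>
    have "l k / r \<le> 1/4" using k L_le r_pos by (simp add: divide_le_eq)
    then have "\<bar>\<phi> (src G k) - \<phi> (rng G k)\<bar> \<le> 1/4" using phi_lipschitz[OF k(1)] by linarith
    moreover have "1/2 < \<phi> (src G k) \<or> 1/2 < \<phi> (rng G k)"
      using pos by (auto simp: weight_def less_max_iff_disj)
    ultimately have "1/4 \<le> \<phi> (src G k)" "1/4 \<le> \<phi> (rng G k)" by linarith+
    then have *: "w (g' \<cdot> k) = w g'" if "g' \<in> arrows G" "src G g' = rng G k" for g'
      using w(5) k that by blast
    \<comment> \<open>The normalising denominator has to be invariant too; this follows by
      translating the fibre sum.\<close>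
    have "fsum w (src G k) = fsum w (rng G k)"
      unfolding fsum_translate[OF k(1)] using * by (rule fsum_cong)
    then show ?thesis using * g k by (simp add: \<nu>_def mult_closed)
  qed
  have \<nu>1: "fsum \<nu> x = 1" if x: "x \<in> units G" "0 < weight x" for x
  proof -
    have "1/4 \<le> \<phi> x" using x(2) by (auto simp: weight_def max_def split: if_splits)
    then have wx: "w x = 1" using w(4) x by blast
    have xa: "x \<in> arrows G" "src G x = x" using x by (auto simp: units_def)
    have "x \<in> fibre T x" using wx w(3) xa by (auto simp: fibre_def not_less[symmetric])
    then have "w x \<le> sum w (fibre T x)"
      using w(2) by (intro member_le_sum finite_fibre) (auto simp: fibre_def)
    then show ?thesis unfolding \<nu>_fsum by (simp add: w_fsum wx)
  qed
  have "fsum \<nu> x \<le> 1" for x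
    unfolding \<nu>_fsum by (simp add: divide_le_eq max_def)
  moreover have "continuous_map (gtop G) euclideanreal \<nu>"
    unfolding \<nu>_def
    using continuous_fsum[OF w(1), of T] w(2,3)
    by (intro continuous_map_real_divide continuous_map_real_max w(1) continuous_map_canonical_const
        continuous_comp_src) auto
  moreover have "\<nu> g \<in> {0..1}" if "g \<in> arrows G" for g
  proof -
    have "0 \<le> w g" "w g \<le> 1" using w(2) that by auto
    then show ?thesis by (simp add: \<nu>_def divide_le_eq max_def)
  qed
  ultimately show ?thesis
    using w(3) inv \<nu>1 by (intro exI[of _ \<nu>] exI[of _ T]) (auto simp: \<nu>_def)
qed

lemma weight_props:
  "continuous_map (unit_space G) euclideanreal weight" "weight x \<in> {0..1}"
  "x \<in> units G \<Longrightarrow> \<rho> x = 1 \<Longrightarrow> weight x = 1"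
  "k \<in> arrows G \<Longrightarrow> \<bar>weight (src G k) - weight (rng G k)\<bar> \<le> 2 * l k / r"
proof -
  show "continuous_map (unit_space G) euclideanreal weight"
    unfolding weight_def
    by (intro continuous_map_real_max continuous_map_diff continuous_map_real_mult_left
        continuous_map_canonical_const continuous_phi)
  show "weight x \<in> {0..1}" using phi01[of x] by (simp add: weight_def)
  show "weight x = 1" if "x \<in> units G" "\<rho> x = 1"
    using rho_le_phi[OF that(1)] phi01[of x] that(2) by (simp add: weight_def)
  show "\<bar>weight (src G k) - weight (rng G k)\<bar> \<le> 2 * l k / r" if "k \<in> arrows G"
    using phi_lipschitz[OF that] unfolding weight_def times_divide_eq_right[symmetric] by linarith
qed

end

section \<open>Perturbation of normalised weights, and plateau functions for a cover\<close>

lemma sum_abs_normalise_diff_le: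
  fixes a b :: "'i \<Rightarrow> real"
  assumes "finite I" and "\<And>i. i \<in> I \<Longrightarrow> 0 \<le> b i" and "1 \<le> sum a I" "1 \<le> sum b I"
  shows "(\<Sum>i \<in> I. \<bar>a i / sum a I - b i / sum b I\<bar>) \<le> 2 * (\<Sum>i \<in> I. \<bar>a i - b i\<bar>)"
proof -
  let ?A = "sum a I" and ?B = "sum b I" and ?D = "\<Sum>i \<in> I. \<bar>a i - b i\<bar>"
  have BA: "\<bar>?B - ?A\<bar> \<le> ?D"
    using sum_abs[of "\<lambda>i. a i - b i" I] by (simp add: sum_subtractf abs_minus_commute)
  have "\<bar>a i / ?A - b i / ?B\<bar> \<le> \<bar>a i - b i\<bar> / ?A + (b i / ?B) * (\<bar>?B - ?A\<bar> / ?A)" if "i \<in> I" for i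
  proof -
    \<comment> \<open>The second summand has total mass at most
      \<open>\<bar>?B - ?A\<bar> / ?A\<close>, because the quotients \<open>b i / ?B\<close> add up
      to \<open>1\<close>; with \<open>?A\<close> at least \<open>1\<close>, each part contributes
      at most \<open>?D\<close>.\<close>
    have "a i / ?A - b i / ?B = (a i - b i) / ?A + (b i / ?B) * ((?B - ?A) / ?A)"
      using assms(3,4) by (simp add: field_simps)
    moreover have "\<bar>(a i - b i) / ?A\<bar> = \<bar>a i - b i\<bar> / ?A"
      using assms(3) by (simp add: abs_divide)
    moreover have "\<bar>(b i / ?B) * ((?B - ?A) / ?A)\<bar> = (b i / ?B) * (\<bar>?B - ?A\<bar> / ?A)"
      using assms(2)[OF that] assms(3,4) by (simp add: abs_mult abs_divide)
    ultimately show ?thesis by linarith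
  qed
  then have "(\<Sum>i \<in> I. \<bar>a i / ?A - b i / ?B\<bar>)
      \<le> (\<Sum>i \<in> I. \<bar>a i - b i\<bar> / ?A + (b i / ?B) * (\<bar>?B - ?A\<bar> / ?A))"
    by (rule sum_mono)
  also have "\<dots> = ?D / ?A + (?B / ?B) * (\<bar>?B - ?A\<bar> / ?A)"
    by (simp only: sum.distrib sum_divide_distrib[symmetric] sum_distrib_right[symmetric])
  also have "\<dots> = ?D / ?A + \<bar>?B - ?A\<bar> / ?A" using assms(4) by simp
  also have "\<dots> \<le> ?D + ?D"
  proof (rule add_mono)
    have "x / ?A \<le> x" if "0 \<le> x" for x
      using that assms(3) mult_left_mono[of 1 ?A x] by (simp add: divide_le_eq)
    then show "?D / ?A \<le> ?D" "\<bar>?B - ?A\<bar> / ?A \<le> ?D"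
      using BA order_trans[of "\<bar>?B - ?A\<bar> / ?A" "\<bar>?B - ?A\<bar>" ?D] by (simp_all add: sum_nonneg)
  qed
  finally show ?thesis by simp
qed

text \<open>Bumps are grouped by the member of the cover outside which they vanish; doubling the
  group sums and truncating at \<open>1\<close> turns a value above \<open>1/2\<close> into the
  plateau value \<open>1\<close>. A weight equal to \<open>1\<close> at every point later keeps the
  total weight at least \<open>1\<close>.\<close>

lemma compact_space_plateau_cover:
  fixes m :: nat
  assumes X: "completely_regular_space X" "compact_space X"
    and U: "\<forall>i \<le> m. openin X (U i)" "(\<Union>i \<le> m. U i) = topspace X"
  shows "\<exists>\<rho> :: nat \<Rightarrow> 'a \<Rightarrow> real. (\<forall>i. continuous_map X euclideanreal (\<rho> i)) \<and>
    (\<forall>i. \<forall>x \<in> topspace X. \<rho> i x \<in> {0..1}) \<and> (\<forall>i. \<forall>x \<in> topspace X. 0 < \<rho> i x \<longrightarrow> x \<in> U i) \<and>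
    (\<forall>x \<in> topspace X. \<exists>i \<le> m. \<rho> i x = 1)"
proof -
  have "\<forall>x \<in> topspace X. \<exists>i. i \<le> m \<and> x \<in> U i" using U(2) by blast
  then obtain \<iota> where \<iota>: "\<forall>x \<in> topspace X. \<iota> x \<le> m \<and> x \<in> U (\<iota> x)" by metis
  then have V: "\<forall>x \<in> topspace X. openin X (U (\<iota> x)) \<and> x \<in> U (\<iota> x)" using U(1) by blast
  have "compactin X (topspace X)" using X(2) by (simp add: compact_space_def)
  from compactin_bump_cover[OF X(1) this V]
  obtain D and f :: "'a \<Rightarrow> 'a \<Rightarrow> real" where D: "finite D" "D \<subseteq> topspace X"
    and f: "\<forall>v \<in> D. continuous_map X euclideanreal (f v)"
    "\<forall>v \<in> D. \<forall>x \<in> topspace X. f v x \<in> {0..1}" "\<forall>v \<in> D. \<forall>x \<in> topspace X - U (\<iota> v). f v x = 0"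
    "\<forall>x \<in> topspace X. \<exists>v \<in> D. 1/2 < f v x"
    by (elim exE conjE)
  \<comment> \<open>For \<open>i > m\<close> this set is empty, so \<open>\<rho> i\<close> is
    constantly \<open>0\<close> and the claims hold for every \<open>i\<close>.\<close>
  define D' where "D' i = {v \<in> D. \<iota> v = i}" for i
  have D': "finite (D' i)" "D' i \<subseteq> D" for i using D by (auto simp: D'_def)
  define \<rho> where "\<rho> i x = min 1 (2 * (\<Sum>v \<in> D' i. f v x))" for i x
  have nn: "0 \<le> (\<Sum>v \<in> D' i. f v x)" if "x \<in> topspace X" for i x
  proof (rule sum_nonneg)
    fix u assume "u \<in> D' i"
    then have "u \<in> D" using D'(2) by blast
    then have "f u x \<in> {0..1}" using f(2) that by blast
    then show "0 \<le> f u x" by simp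
  qed
  show ?thesis
  proof (intro exI[of _ \<rho>] conjI allI ballI impI)
    show "continuous_map X euclideanreal (\<rho> i)" for i
      unfolding \<rho>_def using f(1) D'
      by (intro continuous_map_real_min continuous_map_real_mult_left continuous_map_sum
          continuous_map_canonical_const) auto
    show "\<rho> i x \<in> {0..1}" if "x \<in> topspace X" for i x
      using nn[OF that] by (simp add: \<rho>_def)
    show "x \<in> U i" if "x \<in> topspace X" "0 < \<rho> i x" for i x
    proof (rule ccontr)
      assume "x \<notin> U i"
      then have "f v x = 0" if "v \<in> D' i" for v
        using f(3) that \<open>x \<in> topspace X\<close> by (auto simp: D'_def)
      then show False using that(2) by (simp add: \<rho>_def)
    qed
    show "\<exists>i \<le> m. \<rho> i x = 1" if x: "x \<in> topspace X" for x
    proof -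
      obtain v where v: "v \<in> D" "1/2 < f v x" using f(4) x by blast
      have "f v x \<le> (\<Sum>v \<in> D' (\<iota> v). f v x)"
      proof (rule member_le_sum)
        show "v \<in> D' (\<iota> v)" using v by (simp add: D'_def)
        fix u assume "u \<in> D' (\<iota> v) - {v}"
        then have "u \<in> D" using D'(2) by blast
        then have "f u x \<in> {0..1}" using f(2) x by blast
        then show "0 \<le> f u x" by simp
      qed (rule D'(1))
      then have "\<rho> (\<iota> v) x = 1" using v by (simp add: \<rho>_def)
      then show ?thesis using \<iota> v D(2) by blast
    qed
  qed
qed

subsection \<open>Averaging over a cover\<close>

context coarse_groupoid
begin

text \<open>The mean combines the \<open>\<nu> i\<close> with coefficients \<open>p i\<close>, the
  normalised \<open>a i\<close>, taken at the source. Exact invariance of \<open>\<nu> i\<close>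
  leaves only the change of \<open>p i\<close> along \<open>k\<close>, and normalising costs a
  factor \<open>2\<close> since the total weight is at least \<open>1\<close>.\<close>

lemma exists_almost_invariant_mean:
  fixes a \<nu> :: "nat \<Rightarrow> 'a \<Rightarrow> real" and m :: nat
  assumes a_cont: "\<And>i. i \<le> m \<Longrightarrow> continuous_map (unit_space G) euclideanreal (a i)"
    and a01: "\<And>i x. i \<le> m \<Longrightarrow> a i x \<in> {0..1}"
    and a_cover: "\<And>x. x \<in> units G \<Longrightarrow> \<exists>i \<le> m. a i x = 1"
    and a_diff: "\<And>i k. i \<le> m \<Longrightarrow> k \<in> arrows G \<Longrightarrow> l k \<le> L \<Longrightarrow>
      \<bar>a i (src G k) - a i (rng G k)\<bar> \<le> \<eta>"
    and \<nu>_cont: "\<And>i. i \<le> m \<Longrightarrow> continuous_map (gtop G) euclideanreal (\<nu> i)"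
    and \<nu>01: "\<And>i g. i \<le> m \<Longrightarrow> g \<in> arrows G \<Longrightarrow> \<nu> i g \<in> {0..1}"
    and \<nu>0: "\<And>i g. i \<le> m \<Longrightarrow> g \<in> arrows G \<Longrightarrow> T i < l g \<Longrightarrow> \<nu> i g = 0"
    and \<nu>_le: "\<And>i x. i \<le> m \<Longrightarrow> x \<in> units G \<Longrightarrow> fsum (\<nu> i) x \<le> 1"
    and \<nu>_eq: "\<And>i x. i \<le> m \<Longrightarrow> x \<in> units G \<Longrightarrow> 0 < a i x \<Longrightarrow> fsum (\<nu> i) x = 1"
    and \<nu>_inv: "\<And>i g k. i \<le> m \<Longrightarrow> g \<in> arrows G \<Longrightarrow> k \<in> arrows G \<Longrightarrow> src G g = rng G k \<Longrightarrow> l k \<le> L \<Longrightarrow>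
      0 < a i (src G k) \<or> 0 < a i (rng G k) \<Longrightarrow> \<nu> i (g \<cdot> k) = \<nu> i g"
  shows "\<exists>(\<mu> :: 'a \<Rightarrow> real) S. continuous_map (gtop G) euclideanreal \<mu> \<and> (\<forall>g \<in> arrows G. \<mu> g \<in> {0..1}) \<and>
    (\<forall>g \<in> arrows G. S < l g \<longrightarrow> \<mu> g = 0) \<and> (\<forall>x \<in> units G. fsum \<mu> x = 1) \<and>
    (\<forall>k \<in> arrows G. l k \<le> L \<longrightarrow>
      fsum (\<lambda>g. \<bar>\<mu> g - \<mu> (g \<cdot> k)\<bar>) (rng G k) \<le> 2 * (real (Suc m) * \<eta>))"
proof -
  define A where "A x = (\<Sum>i \<le> m. a i x)" for x
  define p where "p i x = a i x / A x" for i x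
  define \<mu> where "\<mu> g = (\<Sum>i \<le> m. p i (src G g) * \<nu> i g)" for g
  define S where "S = Max (T ` {..m})"
  have a0: "0 \<le> a i x" if "i \<le> m" for i x using a01[OF that, of x] by simp
  have A1: "1 \<le> A x" if x: "x \<in> units G" for x
  proof -
    obtain i where "i \<le> m" "a i x = 1" using a_cover[OF x] by blast
    then show ?thesis
      using member_le_sum[of i "{..m}" "\<lambda>i. a i x"] a0 by (simp add: A_def)
  qed
  have p0: "0 \<le> p i x" if "x \<in> units G" "i \<le> m" for i x
    using a0[OF that(2), of x] A1[OF that(1)] by (simp add: p_def)
  have p_sum: "(\<Sum>i \<le> m. p i x) = 1" if "x \<in> units G" for x
    using A1[OF that] by (simp add: p_def sum_divide_distrib[symmetric] A_def[symmetric])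
  have S: "\<nu> i g = 0" if "i \<le> m" "g \<in> arrows G" "S < l g" for i g
  proof (rule \<nu>0)
    have "T i \<le> S" unfolding S_def using that(1) by (intro Max_ge) auto
    then show "T i < l g" using that(3) by simp
  qed (use that in auto)
  have \<nu>S: "fsum (\<nu> i) x = sum (\<nu> i) (fibre S x)" if "i \<le> m" for i x
    using S[OF that] by (rule fsum_eq)
  have \<mu>0: "\<mu> g = 0" if "g \<in> arrows G" "S < l g" for g
    using S that by (simp add: \<mu>_def)
  have \<mu>_fsum: "fsum \<mu> x = 1" if x: "x \<in> units G" for x
  proof -
    have "fsum \<mu> x = sum \<mu> (fibre S x)" using \<mu>0 by (rule fsum_eq)
    also have "\<dots> = (\<Sum>g \<in> fibre S x. \<Sum>i \<le> m. p i x * \<nu> i g)"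
      by (intro sum.cong refl) (simp add: \<mu>_def fibre_def)
    also have "\<dots> = (\<Sum>i \<le> m. p i x * fsum (\<nu> i) x)"
      by (subst sum.swap) (simp add: \<nu>S sum_distrib_left)
    also have "\<dots> = (\<Sum>i \<le> m. p i x)"
    proof (rule sum.cong[OF refl])
      fix i assume "i \<in> {..m}"
      then show "p i x * fsum (\<nu> i) x = p i x"
        using \<nu>_eq[of i x] a0[of i x] x by (cases "a i x = 0") (simp_all add: p_def)
    qed
    finally show ?thesis using p_sum[OF x] by simp
  qed
  have \<mu>01: "\<mu> g \<in> {0..1}" if g: "g \<in> arrows G" for g
  proof -
    note x = src_unit[OF g]
    have "0 \<le> \<mu> g"
      unfolding \<mu>_def using p0[OF x] \<nu>01[OF _ g] by (intro sum_nonneg mult_nonneg_nonneg) auto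
    moreover have "\<mu> g \<le> (\<Sum>i \<le> m. p i (src G g))"
      unfolding \<mu>_def using p0[OF x] \<nu>01[OF _ g] by (intro sum_mono mult_left_le) auto
    ultimately show ?thesis using p_sum[OF x] by simp
  qed
  have \<mu>_cont: "continuous_map (gtop G) euclideanreal \<mu>"
  proof -
    have "continuous_map (unit_space G) euclideanreal A"
      unfolding A_def by (intro continuous_map_sum a_cont) auto
    then have "continuous_map (unit_space G) euclideanreal (p i)" if "i \<le> m" for i
      unfolding p_def using A1 by (intro continuous_map_real_divide a_cont that)
        (fastforce simp: topspace_unit_space)+
    then show ?thesis
      unfolding \<mu>_def
      by (intro continuous_map_sum continuous_map_real_mult continuous_comp_src \<nu>_cont) auto
  qed
  have diff: "fsum (\<lambda>g. \<bar>\<mu> g - \<mu> (g \<cdot> k)\<bar>) (rng G k) \<le> 2 * (real (Suc m) * \<eta>)"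
    if k: "k \<in> arrows G" "l k \<le> L" for k
  proof -
    let ?x = "rng G k" and ?y = "src G k"
    have x: "?x \<in> units G" and y: "?y \<in> units G" using k rng_unit src_unit by auto
    have eq: "\<mu> g - \<mu> (g \<cdot> k) = (\<Sum>i \<le> m. (p i ?x - p i ?y) * \<nu> i g)"
      if g: "g \<in> arrows G" "src G g = ?x" for g
    proof -
      have "p i ?x * \<nu> i g - p i ?y * \<nu> i (g \<cdot> k) = (p i ?x - p i ?y) * \<nu> i g" if i: "i \<le> m" for i
      \<comment> \<open>If both coefficients vanish, so do both products; otherwise
        \<open>\<nu>_inv\<close> applies to \<open>g\<close> and \<open>k\<close>.\<close>
      proof (cases "a i ?x = 0 \<and> a i ?y = 0")
        case False
        then have "0 < a i ?y \<or> 0 < a i ?x" using a0[OF i, of ?x] a0[OF i, of ?y] by linarith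
        then have "\<nu> i (g \<cdot> k) = \<nu> i g" using \<nu>_inv i g k by blast
        then show ?thesis by (simp add: left_diff_distrib)
      qed (simp add: p_def)
      then show ?thesis
        using mult_closed[OF g(1) k(1) g(2)] g by (simp add: \<mu>_def sum_subtractf[symmetric])
    qed
    define F where "F g = (\<Sum>i \<le> m. (p i ?x - p i ?y) * \<nu> i g)" for g
    have "fsum (\<lambda>g. \<bar>\<mu> g - \<mu> (g \<cdot> k)\<bar>) ?x = fsum (\<lambda>g. \<bar>F g\<bar>) ?x"
      using eq by (intro fsum_cong) (simp add: F_def)
    also have "\<dots> = (\<Sum>g \<in> fibre S ?x. \<bar>F g\<bar>)"
      using S by (intro fsum_eq) (simp add: F_def)
    also have "\<dots> \<le> (\<Sum>g \<in> fibre S ?x. \<Sum>i \<le> m. \<bar>p i ?x - p i ?y\<bar> * \<nu> i g)"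
    proof (rule sum_mono)
      fix g assume "g \<in> fibre S ?x"
      then have "g \<in> arrows G" by (simp add: fibre_def)
      have "\<bar>F g\<bar> \<le> (\<Sum>i \<le> m. \<bar>(p i ?x - p i ?y) * \<nu> i g\<bar>)" unfolding F_def by (rule sum_abs)
      also have "\<dots> = (\<Sum>i \<le> m. \<bar>p i ?x - p i ?y\<bar> * \<nu> i g)"
        using \<nu>01[OF _ \<open>g \<in> arrows G\<close>] by (intro sum.cong refl) (simp add: abs_mult)
      finally show "\<bar>F g\<bar> \<le> (\<Sum>i \<le> m. \<bar>p i ?x - p i ?y\<bar> * \<nu> i g)" .
    qed
    also have "\<dots> = (\<Sum>i \<le> m. \<bar>p i ?x - p i ?y\<bar> * fsum (\<nu> i) ?x)"
      by (subst sum.swap) (simp add: \<nu>S sum_distrib_left)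
    also have "\<dots> \<le> (\<Sum>i \<le> m. \<bar>p i ?x - p i ?y\<bar>)"
      using \<nu>_le[OF _ x] by (intro sum_mono mult_left_le) auto
    also have "\<dots> \<le> 2 * (\<Sum>i \<le> m. \<bar>a i ?x - a i ?y\<bar>)"
      unfolding p_def A_def using a0 A1[OF x] A1[OF y]
      by (intro sum_abs_normalise_diff_le) (auto simp: A_def)
    also have "\<dots> \<le> 2 * (\<Sum>i \<le> m. \<eta>)"
      using a_diff[OF _ k] by (intro mult_left_mono sum_mono) (auto simp: abs_minus_commute)
    finally show ?thesis by simp
  qed
  show ?thesis
    using \<mu>_cont \<mu>01 \<mu>0 \<mu>_fsum diff by (intro exI[of _ \<mu>] exI[of _ S]) blast
qed

lemma exists_mean_of_cover:
  fixes m :: nat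
  assumes U: "\<forall>i \<le> m. openin (unit_space G) (U i)" "(\<Union>i \<le> m. U i) = units G"
    and H: "\<And>i. i \<le> m \<Longrightarrow> \<exists>H. subgroupoid G H \<and> precompactin (gtop G) H \<and>
      {g \<in> arrows G. l g < 4 * r \<and> src G g \<in> U i \<and> rng G g \<in> U i} \<subseteq> H"
    and L: "0 < L" "4 * L \<le> r"
  shows "\<exists>(\<mu> :: 'a \<Rightarrow> real) S. continuous_map (gtop G) euclideanreal \<mu> \<and> (\<forall>g \<in> arrows G. \<mu> g \<in> {0..1}) \<and>
    (\<forall>g \<in> arrows G. S < l g \<longrightarrow> \<mu> g = 0) \<and> (\<forall>x \<in> units G. fsum \<mu> x = 1) \<and>
    (\<forall>k \<in> arrows G. l k \<le> L \<longrightarrow>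
      fsum (\<lambda>g. \<bar>\<mu> g - \<mu> (g \<cdot> k)\<bar>) (rng G k) \<le> 2 * (real (Suc m) * (2 * L / r)))"
proof -
  have "(\<Union>i \<le> m. U i) = topspace (unit_space G)" using U(2) by (simp add: topspace_unit_space)
  from compact_space_plateau_cover[OF completely_regular_units compact_units U(1) this]
  obtain \<rho> :: "nat \<Rightarrow> 'a \<Rightarrow> real" where \<rho>: "\<forall>i. continuous_map (unit_space G) euclideanreal (\<rho> i)"
    "\<forall>i. \<forall>x \<in> topspace (unit_space G). \<rho> i x \<in> {0..1}"
    "\<forall>i. \<forall>x \<in> topspace (unit_space G). 0 < \<rho> i x \<longrightarrow> x \<in> U i"
    "\<forall>x \<in> topspace (unit_space G). \<exists>i \<le> m. \<rho> i x = 1"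
    by (elim exE conjE)
  have "\<forall>i. \<exists>H'. i \<le> m \<longrightarrow> subgroupoid G H' \<and> precompactin (gtop G) H' \<and>
      {g \<in> arrows G. l g < 4 * r \<and> src G g \<in> U i \<and> rng G g \<in> U i} \<subseteq> H'"
    using H by blast
  from choice[OF this] obtain H' where H': "\<And>i. i \<le> m \<Longrightarrow> subgroupoid G (H' i) \<and>
      precompactin (gtop G) (H' i) \<and>
      {g \<in> arrows G. l g < 4 * r \<and> src G g \<in> U i \<and> rng G g \<in> U i} \<subseteq> H' i"
    by blast
  have co: "cutoff G l (\<rho> i) (U i) (H' i) r L" if "i \<le> m" for i
  proof -
    have "cutoff_axioms G l (\<rho> i) (U i) (H' i) r L"
      using \<rho>(1-3) H'[OF that] L by unfold_locales (auto simp: topspace_unit_space)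
    then show ?thesis using coarse_groupoid_axioms by (simp add: cutoff_def)
  qed
  define a where "a i = cutoff.weight G l (\<rho> i) r" for i
  define R where "R i \<nu> T \<longleftrightarrow> continuous_map (gtop G) euclideanreal \<nu> \<and> (\<forall>g \<in> arrows G. \<nu> g \<in> {0..1}) \<and>
    (\<forall>g \<in> arrows G. T < l g \<longrightarrow> \<nu> g = 0) \<and>
    (\<forall>x \<in> units G. fsum \<nu> x \<le> 1) \<and> (\<forall>x \<in> units G. 0 < a i x \<longrightarrow> fsum \<nu> x = 1) \<and>
    (\<forall>g \<in> arrows G. \<forall>k \<in> arrows G. src G g = rng G k \<and> l k \<le> L \<and>
      (0 < a i (src G k) \<or> 0 < a i (rng G k)) \<longrightarrow> \<nu> (g \<cdot> k) = \<nu> g)"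
    for i and \<nu> :: "'a \<Rightarrow> real" and T :: real
  have "\<exists>\<nu> T. R i \<nu> T" if "i \<le> m" for i
    unfolding R_def a_def using cutoff.exists_normalised_kernel[OF co[OF that]] .
  then obtain \<nu> T where "\<And>i. i \<le> m \<Longrightarrow> R i (\<nu> i) (T i)" by metis
  note \<nu> = this[unfolded R_def]
  have r: "0 < r" using L by linarith
  show ?thesis
  proof (rule exists_almost_invariant_mean[of m a L _ \<nu> T])
    show "continuous_map (unit_space G) euclideanreal (a i)" "a i x \<in> {0..1}" if "i \<le> m" for i x
      unfolding a_def using cutoff.weight_props(1,2)[OF co[OF that]] by blast+
    show "\<exists>i \<le> m. a i x = 1" if "x \<in> units G" for x
      unfolding a_def using \<rho>(4) cutoff.weight_props(3)[OF co] that by (metis topspace_unit_space)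
    \<comment> \<open>The weight has slope at most \<open>2\<close> in \<open>\<phi>\<close>, which
      is \<open>1/r\<close>-Lipschitz along arrows; this gives the modulus
      \<open>2 * L / r\<close>.\<close>
    show "\<bar>a i (src G k) - a i (rng G k)\<bar> \<le> 2 * L / r" if "i \<le> m" "k \<in> arrows G" "l k \<le> L" for i k
    proof -
      have "2 * l k / r \<le> 2 * L / r" using that(3) r by (simp add: divide_right_mono)
      then show ?thesis
        unfolding a_def using cutoff.weight_props(4)[OF co[OF that(1)] that(2)] by linarith
    qed
  qed (use \<nu> in blast)+
qed

lemma amenable_if_small_covers:
  assumes small: "\<And>L \<epsilon> :: real. 0 < L \<Longrightarrow> 0 < \<epsilon> \<Longrightarrow>
    \<exists>r m. 4 * L \<le> r \<and> dad G l (4 * r) = enat m \<and> 2 * (real (Suc m) * (2 * L / r)) < \<epsilon>"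
  shows "amenable G"
  unfolding amenable_def
proof (intro allI impI)
  fix K and \<epsilon> :: real
  assume K\<epsilon>: "compactin (gtop G) K \<and> 0 < \<epsilon>"
  then obtain L0 where "\<And>k. k \<in> K \<Longrightarrow> l k \<le> L0"
    using bounded_on_compact[of K] by (auto simp: bdd_above_def)
  then have KL: "k \<in> arrows G" "l k \<le> max 1 L0" if "k \<in> K" for k
    using that K\<epsilon> compactin_subset_topspace by (fastforce simp: arrows_def)+
  obtain r m where r: "4 * max 1 L0 \<le> r" "dad G l (4 * r) = enat m"
    "2 * (real (Suc m) * (2 * max 1 L0 / r)) < \<epsilon>"
  proof -
    have "0 < max 1 L0" by (rule less_le_trans[of 0 1]) auto
    from small[OF this conjunct2[OF K\<epsilon>]] show thesis using that by blast
  qed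
  define P where "P m \<longleftrightarrow> (\<exists>U :: nat \<Rightarrow> 'a set.
      (\<forall>i \<le> m. openin (unit_space G) (U i)) \<and>
      (\<Union>i \<le> m. U i) = units G \<and>
      (\<forall>i \<le> m. \<exists>H. subgroupoid G H \<and> precompactin (gtop G) H \<and>
        {g \<in> arrows G. l g < 4 * r \<and> src G g \<in> U i \<and> rng G g \<in> U i} \<subseteq> H))" for m :: nat
  have "P m"
  proof -
    \<comment> \<open>An infimum of \<open>enat\<close> values is attained unless the set is empty,
      when it is infinite; a finite \<open>dad\<close> thus provides an actual cover.\<close>
    have *: "Inf (enat ` {m. P m}) = enat m" using r(2) by (simp add: dad_def P_def)
    then have "enat ` {m. P m} \<noteq> {}" by (auto simp: Inf_enat_def split: if_splits)
    then have "Inf (enat ` {m. P m}) \<in> enat ` {m. P m}"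
      unfolding Inf_enat_def by (auto intro: LeastI)
    then show ?thesis unfolding * by auto
  qed
  then obtain U where U: "\<forall>i \<le> m. openin (unit_space G) (U i)" "(\<Union>i \<le> m. U i) = units G"
    "\<forall>i \<le> m. \<exists>H. subgroupoid G H \<and> precompactin (gtop G) H \<and>
        {g \<in> arrows G. l g < 4 * r \<and> src G g \<in> U i \<and> rng G g \<in> U i} \<subseteq> H"
    unfolding P_def by (elim exE conjE)
  have "\<exists>(\<mu> :: 'a \<Rightarrow> real) S. continuous_map (gtop G) euclideanreal \<mu> \<and> (\<forall>g \<in> arrows G. \<mu> g \<in> {0..1}) \<and>
    (\<forall>g \<in> arrows G. S < l g \<longrightarrow> \<mu> g = 0) \<and> (\<forall>x \<in> units G. fsum \<mu> x = 1) \<and>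
    (\<forall>k \<in> arrows G. l k \<le> max 1 L0 \<longrightarrow>
      fsum (\<lambda>g. \<bar>\<mu> g - \<mu> (g \<cdot> k)\<bar>) (rng G k) \<le> 2 * (real (Suc m) * (2 * max 1 L0 / r)))"
    using U r(1) less_le_trans[of 0 1 "max 1 L0"] by (intro exists_mean_of_cover[of m U]) auto
  then obtain \<mu> :: "'a \<Rightarrow> real" and S where \<mu>: "continuous_map (gtop G) euclideanreal \<mu>"
    "\<forall>g \<in> arrows G. \<mu> g \<in> {0..1}" "\<forall>g \<in> arrows G. S < l g \<longrightarrow> \<mu> g = 0" "\<forall>x \<in> units G. fsum \<mu> x = 1"
    "\<forall>k \<in> arrows G. l k \<le> max 1 L0 \<longrightarrow>
      fsum (\<lambda>g. \<bar>\<mu> g - \<mu> (g \<cdot> k)\<bar>) (rng G k) \<le> 2 * (real (Suc m) * (2 * max 1 L0 / r))"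
    by (elim exE conjE)
  show "\<exists>\<mu> :: 'a \<Rightarrow> real.
        continuous_map (gtop G) (top_of_set {0..1}) \<mu> \<and>
        compactin (gtop G) (gtop G closure_of {g \<in> arrows G. \<mu> g \<noteq> 0}) \<and>
        (\<forall>x \<in> units G. (\<Sum>\<^sub>\<infinity>g \<in> {g \<in> arrows G. src G g = x}. \<mu> g) \<le> 1) \<and>
        (\<forall>k \<in> K. \<bar>1 - (\<Sum>\<^sub>\<infinity>g \<in> {g \<in> arrows G. src G g = rng G k}. \<mu> g)\<bar> < \<epsilon>) \<and>
        (\<forall>k \<in> K. (\<Sum>\<^sub>\<infinity>g \<in> {g \<in> arrows G. src G g = rng G k}. \<bar>\<mu> g - \<mu> (g \<cdot> k)\<bar>) < \<epsilon>)"
    unfolding fsum_def[symmetric]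
  proof (intro exI[of _ \<mu>] conjI ballI)
    show "continuous_map (gtop G) (top_of_set {0..1}) \<mu>"
      using \<mu>(1,2) by (intro continuous_map_into_subtopology) (auto simp: arrows_def)
    have "{g \<in> arrows G. \<mu> g \<noteq> 0} \<subseteq> {g \<in> arrows G. l g \<le> S}"
      using \<mu>(3) by (auto simp: not_less[symmetric])
    then have "gtop G closure_of {g \<in> arrows G. \<mu> g \<noteq> 0} \<subseteq> {g \<in> arrows G. l g \<le> S}"
      using compactin_imp_closedin[OF Hausdorff compactin_ball] by (rule closure_of_minimal)
    then show "compactin (gtop G) (gtop G closure_of {g \<in> arrows G. \<mu> g \<noteq> 0})"
      using compactin_ball closed_compactin closedin_closure_of by blast
    show "fsum \<mu> x \<le> 1" if "x \<in> units G" for x using \<mu>(4) that by simp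
    show "\<bar>1 - fsum \<mu> (rng G k)\<bar> < \<epsilon>" if "k \<in> K" for k
      using \<mu>(4) rng_unit[OF KL(1)[OF that]] K\<epsilon> by simp
    show "fsum (\<lambda>g. \<bar>\<mu> g - \<mu> (g \<cdot> k)\<bar>) (rng G k) < \<epsilon>" if "k \<in> K" for k
      using \<mu>(5) KL[OF that] r(3) by fastforce
  qed
qed

end

section \<open>Choice of the scale under sublinear growth\<close>

lemma sublinear_growth_small:
  fixes c L \<alpha> \<epsilon> :: real
  assumes "0 < c" "0 < L" "\<alpha> < 1" "0 < \<alpha>" "0 < \<epsilon>"
  shows "\<exists>r \<ge> 4 * L. c < r \<and>
    (\<forall>m. m \<le> c * (c * (4 * r) + c) powr \<alpha> + c \<longrightarrow> 2 * ((m + 1) * (2 * L / r)) < \<epsilon>)"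
proof -
  \<comment> \<open>For \<open>r \<ge> 1\<close> the defect is at most
    \<open>C * r powr (\<alpha> - 1)\<close>, which tends to \<open>0\<close> because
    \<open>\<alpha> < 1\<close>.\<close>
  define C where "C = 4 * L * (c * (5 * c) powr \<alpha> + c + 1)"
  have C: "0 < C" unfolding C_def using assms by (intro mult_pos_pos add_nonneg_pos) auto
  have "((\<lambda>r :: real. r powr (\<alpha> - 1)) \<longlongrightarrow> 0) at_top"
    using assms(3) by (intro tendsto_neg_powr filterlim_ident) simp
  then have "\<forall>\<^sub>F r in at_top. r powr (\<alpha> - 1) < \<epsilon> / C"
    using assms(5) C by (auto intro: order_tendstoD)
  then have "\<forall>\<^sub>F r in at_top. r powr (\<alpha> - 1) < \<epsilon> / C \<and> 4 * L \<le> r \<and> c < r \<and> 1 \<le> r"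
    by (intro eventually_conj eventually_ge_at_top eventually_gt_at_top)
  then obtain r where r: "r powr (\<alpha> - 1) < \<epsilon> / C" "4 * L \<le> r" "c < r" "1 \<le> r"
    using eventually_happens'[OF trivial_limit_at_top_linorder] by blast
  have "2 * ((m + 1) * (2 * L / r)) < \<epsilon>" if m: "m \<le> c * (c * (4 * r) + c) powr \<alpha> + c" for m
  proof -
    have "c \<le> c * r" using assms(1) r(4) by simp
    then have "(c * (4 * r) + c) powr \<alpha> \<le> (5 * c * r) powr \<alpha>"
      using assms r by (intro powr_mono2) auto
    also have "\<dots> = (5 * c) powr \<alpha> * r powr \<alpha>" using assms r by (simp add: powr_mult)
    finally have "c * (c * (4 * r) + c) powr \<alpha> \<le> c * ((5 * c) powr \<alpha> * r powr \<alpha>)"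
      using assms(1) by (intro mult_left_mono) auto
    with m have "m + 1 \<le> c * ((5 * c) powr \<alpha> * r powr \<alpha>) + c + 1" by linarith
    also have "\<dots> \<le> c * ((5 * c) powr \<alpha> * r powr \<alpha>) + (c + 1) * r powr \<alpha>"
      using assms r(4) ge_one_powr_ge_zero[of r \<alpha>] mult_left_mono[of 1 "r powr \<alpha>" "c + 1"] by simp
    also have "\<dots> = (c * (5 * c) powr \<alpha> + c + 1) * r powr \<alpha>" by (simp add: algebra_simps)
    finally have "4 * L / r * (m + 1) \<le> 4 * L / r * ((c * (5 * c) powr \<alpha> + c + 1) * r powr \<alpha>)"
      using assms r by (intro mult_left_mono) auto
    also have "\<dots> = C * r powr (\<alpha> - 1)"
      using r by (simp add: C_def powr_diff)
    also have "\<dots> < \<epsilon>" using r(1) C by (simp add: pos_less_divide_eq mult.commute)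
    finally show ?thesis by (simp add: field_simps)
  qed
  then show ?thesis using r by blast
qed

theorem theorem1p4:
  fixes G :: "('a, 'b) top_groupoid_scheme" and l :: "'a \<Rightarrow> real" and \<alpha> :: real
  assumes "etale_groupoid G"
    and "Hausdorff_space (gtop G)"
    and "locally_compact_space (gtop G)"
    and "sigma_compact_space (gtop G)"
    and "compact_space (unit_space G)"
    and "length_function G l"
    and "coarse_length G l"
    and "continuous_map (gtop G) euclideanreal l"
    and "0 < \<alpha>" and "\<alpha> < 1"
    and "growth_le (\<lambda>R. ereal_of_enat (dad G l R)) (\<lambda>x. ereal (x powr \<alpha>))"
  shows "amenable G"
proof -
  interpret coarse_groupoid G l
    using assms(1-3,5-8) by (simp add: coarse_groupoid_def coarse_groupoid_axioms_def)
  obtain k :: nat where k: "\<And>x. real k < x \<Longrightarrow> ereal_of_enat (dad G l x)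
      \<le> ereal (real k) * ereal ((real k * x + real k) powr \<alpha>) + ereal (real k)"
    using assms(11) unfolding growth_le_def by blast
  \<comment> \<open>\<open>k\<close> may be \<open>0\<close>, whereas the choice of scale asks for a
    positive constant; enlarging it only weakens the bound.\<close>
  define c where "c = real k + 1"
  have dad: "\<exists>m. dad G l x = enat m \<and> real m \<le> c * (c * x + c) powr \<alpha> + c" if x: "c < x" for x
  proof -
    have kx: "real k < x" using x by (simp add: c_def)
    have le: "ereal_of_enat (dad G l x) \<le> ereal (real k * (real k * x + real k) powr \<alpha> + real k)"
      using k[OF kx] by simp
    \<comment> \<open>The right-hand side is a finite real, so \<open>dad\<close> cannot be
      infinite.\<close>
    then obtain m where m: "dad G l x = enat m" by (cases "dad G l x") auto
    have "real m \<le> real k * (real k * x + real k) powr \<alpha> + real k" using le m by simp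
    also have "\<dots> \<le> c * (c * x + c) powr \<alpha> + c"
      using kx assms(9) by (intro add_mono mult_mono powr_mono2) (auto simp: c_def)
    finally show ?thesis using m by blast
  qed
  show ?thesis
  proof (rule amenable_if_small_covers)
    fix L \<epsilon> :: real assume "0 < L" "0 < \<epsilon>"
    then obtain r where r: "4 * L \<le> r" "c < r"
      "\<forall>m. m \<le> c * (c * (4 * r) + c) powr \<alpha> + c \<longrightarrow> 2 * ((m + 1) * (2 * L / r)) < \<epsilon>"
      using sublinear_growth_small[of c L \<alpha> \<epsilon>] assms(9,10) by (auto simp: c_def)
    have "c < 4 * r" using r(2) by (simp add: c_def)
    then obtain m where m: "dad G l (4 * r) = enat m" "real m \<le> c * (c * (4 * r) + c) powr \<alpha> + c"
      using dad by blast
    then have "2 * ((real m + 1) * (2 * L / r)) < \<epsilon>" using r(3) by blast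
    moreover have "real (Suc m) = real m + 1" by simp
    ultimately show "\<exists>r m. 4 * L \<le> r \<and> dad G l (4 * r) = enat m \<and> 2 * (real (Suc m) * (2 * L / r)) < \<epsilon>"
      using r(1) m(1) by metis
  qed
qed

end
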